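(* Let $(f_\alpha)_{\alpha\geqslant1}$ be the Manneville–Pomeau family on $[0,1]$, $$f_\alpha(x)=\begin{cases}x(1+2^\alpha x^\alpha)&\text{if }x\in[0,\tfrac12)\\ 2x-1&\text{if }x\in[\tfrac12,1],\end{cases}$$ and let $\varphi_{\alpha,1}=-\log|f_\alpha'|$. Then $\#\,\mathcal{T}_{\varphi_{\alpha,1}}(P_{\mathrm{top}})\geqslant2$. In particular, for every $\alpha\geqslant1$ the map $P_{\mathrm{top}}:C^0([0,1])\to\mathbb{R}$ is Gateaux differentiable, though its extension to $B_m([0,1])$ is not Gateaux differentiable at $\varphi_{\alpha,1}$.
   Context: $B_m([0,1])$ is the space of bounded Borel measurable functions $[0,1]\to\mathbb{R}$ with the supremum norm, and $C^0([0,1])$ its subspace of continuous functions. The extension of the pressure of $f_\alpha$ to $B_m([0,1])$ is the function $P(f_\alpha,\varphi)=\log r(\mathcal{L}_\varphi)$, where $\mathcal{L}_\varphi:B_m([0,1])\to B_m([0,1])$, $\mathcal{L}_\varphi(\psi)(x)=\sum_{f_\alpha(y)=x}e^{\varphi(y)}\psi(y)$, and $r(\mathcal{L}_\varphi)=\lim_n\|\mathcal{L}_\varphi^n\|^{1/n}$ is its spectral radius; on $C^0([0,1])$ it coincides with the topological pressure $P_{\mathrm{top}}(f_\alpha,\cdot)$, abbreviated $P_{\mathrm{top}}$. $\mathcal{T}_{\varphi}(P_{\mathrm{top}})$ is the set of tangent functionals at $\varphi$ of the pressure on $B_m([0,1])$: the finitely additive Borel probability measures $\mu$ on $[0,1]$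 with $P(f_\alpha,\varphi+\psi)-P(f_\alpha,\varphi)\geqslant\int\psi\,d\mu$ for every $\psi\in B_m([0,1])$. A function $\Gamma$ on a Banach space $\mathbf{B}$ is Gateaux differentiable at $\varphi$ if $\lim_{t\to0}\frac1t[\Gamma(\varphi+t\psi)-\Gamma(\varphi)]$ exists and is finite for every $\psi\in\mathbf{B}$.
   Formalization: Differentiability on C^0([0,1]) is proved at φ_{α,1} along all continuous directions, not at every point of C^0, where it fails (a Hofbauer-type potential with tangent functionals δ_0 and δ_1); as φ_{α,1} jumps at 1/2, the pressure is taken on φ_{α,1}+C^0. *)

theory Defs
  imports "HOL-Analysis.Analysis"
begin

text \<open>
  Functions on the unit interval are total functions on the reals; only their values on
  \<open>{0..1}\<close> enter the definitions below.
\<close>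

definition mp_map :: "real \<Rightarrow> real \<Rightarrow> real" where
  "mp_map \<alpha> x = (if x < 1/2 then x * (1 + 2 powr \<alpha> * x powr \<alpha>) else 2 * x - 1)"

definition mp_branch :: "real \<Rightarrow> real set" where
  "mp_branch x = (if x < 1/2 then {0..<1/2} else {1/2..1})"

text \<open>
  The map is discontinuous at \<open>1/2\<close>, so its derivative is taken within the branch containing the
  point; it is one-sided at \<open>0\<close>, \<open>1/2\<close> (where it equals \<open>2\<close>) and \<open>1\<close>.
\<close>

definition geometric_potential :: "real \<Rightarrow> real \<Rightarrow> real" where
  "geometric_potential \<alpha> x =
     - ln \<bar>vector_derivative (mp_map \<alpha>) (at x within mp_branch x)\<bar>"

lemma geometric_potential_eq:
  assumes "\<alpha> \<ge> 1" "x \<in> {0..1}"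
  shows "geometric_potential \<alpha> x =
    - ln (if x < 1/2 then 1 + (1 + \<alpha>) * (2 powr \<alpha> * x powr \<alpha>) else 2)"
proof -
  have nt: "at x within mp_branch x \<noteq> bot"
  proof (cases "x < 1/2")
    case True
    then have "at x within {0..<1/2} \<noteq> bot"
      using assms(2) islimpt_Ico[of 0 "1/2" x] by (simp add: trivial_limit_within)
    with True show ?thesis by (simp add: mp_branch_def)
  next
    case False
    then have "at x within {1/2..1} \<noteq> bot"
      using assms(2) islimpt_Icc[of "1/2" 1 x] by (simp add: trivial_limit_within)
    with False show ?thesis by (simp add: mp_branch_def)
  qed
  let ?d = "if x < 1/2 then 1 + (1 + \<alpha>) * (2 powr \<alpha> * x powr \<alpha>) else 2"
  have pw: "((\<lambda>y. y * y powr \<alpha>) has_real_derivative (1 + \<alpha>) * x powr \<alpha>) (at x within {0..<1/2})"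
    if "x < 1/2"
  proof (cases "x = 0")
    case True
    have "((\<lambda>y::real. y powr \<alpha>) \<longlongrightarrow> 0) (at 0 within {0..<1/2})"
      using assms(1) by (intro tendsto_zero_powrI[where b = \<alpha>] tendsto_ident_at
          tendsto_const) (auto simp: eventually_at_filter)
    then have "((\<lambda>y::real. (y * y powr \<alpha> - 0 * 0 powr \<alpha>) / (y - 0)) \<longlongrightarrow> 0) (at 0 within {0..<1/2})"
      by (rule Lim_transform_eventually) (auto simp: eventually_at_filter)
    with True show ?thesis by (simp add: has_field_derivative_iff)
  next
    case False
    then have "x > 0" using assms(2) by auto
    then have "((\<lambda>y. y * y powr \<alpha>) has_real_derivative
        x * (\<alpha> * x powr (\<alpha> - 1)) + 1 * x powr \<alpha>) (at x within {0..<1/2})"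
      by (auto intro!: derivative_eq_intros has_real_derivative_powr[THEN DERIV_subset])
    moreover have "x * (\<alpha> * x powr (\<alpha> - 1)) + 1 * x powr \<alpha> = (1 + \<alpha>) * x powr \<alpha>"
      using \<open>x > 0\<close> by (simp add: powr_diff algebra_simps)
    ultimately show ?thesis by simp
  qed
  have "(mp_map \<alpha> has_real_derivative ?d) (at x within mp_branch x)"
  proof (cases "x < 1/2")
    case True
    have "((\<lambda>y. y + 2 powr \<alpha> * (y * y powr \<alpha>)) has_real_derivative
        1 + 2 powr \<alpha> * ((1 + \<alpha>) * x powr \<alpha>)) (at x within {0..<1/2})"
      by (intro DERIV_add DERIV_ident DERIV_cmult pw True)
    then have "((\<lambda>y. y + 2 powr \<alpha> * (y * y powr \<alpha>)) has_real_derivative ?d) (at x within {0..<1/2})"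
      using True by (simp add: algebra_simps)
    then have "(mp_map \<alpha> has_real_derivative ?d) (at x within {0..<1/2})"
      by (rule has_field_derivative_transform_within[where d = 1])
        (use True assms in \<open>auto simp: mp_map_def algebra_simps\<close>)
    with True show ?thesis by (simp add: mp_branch_def)
  next
    case False
    have "((\<lambda>y. 2 * y - 1) has_real_derivative ?d) (at x within {1/2..1})"
      using False by (auto intro!: derivative_eq_intros)
    then have "(mp_map \<alpha> has_real_derivative ?d) (at x within {1/2..1})"
      by (rule has_field_derivative_transform_within[where d = 1])
        (use False assms in \<open>auto simp: mp_map_def\<close>)
    with False show ?thesis by (simp add: mp_branch_def)
  qed
  then have "vector_derivative (mp_map \<alpha>) (at x within mp_branch x) = ?d"
    using nt by (intro vector_derivative_within)
      (auto simp: has_real_derivative_iff_has_vector_derivative)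
  moreover have "?d > 0" using assms by (auto intro!: add_pos_nonneg)
  ultimately show ?thesis unfolding geometric_potential_def by simp
qed

abbreviation unit_borel :: "real measure" where
  "unit_borel \<equiv> restrict_space borel {0..1}"

definition bounded_borel :: "(real \<Rightarrow> real) set" where
  "bounded_borel = {\<psi> \<in> borel_measurable unit_borel. bounded (\<psi> ` {0..1})}"

definition continuous_functions :: "(real \<Rightarrow> real) set" where
  "continuous_functions = {\<psi>. continuous_on {0..1} \<psi>}"

definition sup_norm :: "(real \<Rightarrow> real) \<Rightarrow> real" where
  "sup_norm \<psi> = (SUP x\<in>{0..1}. \<bar>\<psi> x\<bar>)"

definition transfer_operator ::
    "(real \<Rightarrow> real) \<Rightarrow> (real \<Rightarrow> real) \<Rightarrow> (real \<Rightarrow> real) \<Rightarrow> real \<Rightarrow> real" where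
  "transfer_operator f \<phi> \<psi> x = (\<Sum>y | y \<in> {0..1} \<and> f y = x. exp (\<phi> y) * \<psi> y)"

definition operator_norm :: "((real \<Rightarrow> real) \<Rightarrow> real \<Rightarrow> real) \<Rightarrow> real" where
  "operator_norm T = (SUP \<psi>\<in>{\<psi> \<in> bounded_borel. sup_norm \<psi> \<le> 1}. sup_norm (T \<psi>))"

definition spectral_radius :: "((real \<Rightarrow> real) \<Rightarrow> real \<Rightarrow> real) \<Rightarrow> real" where
  "spectral_radius T = lim (\<lambda>n. root n (operator_norm (T ^^ n)))"

definition pressure :: "(real \<Rightarrow> real) \<Rightarrow> (real \<Rightarrow> real) \<Rightarrow> real" where
  "pressure f \<phi> = ln (spectral_radius (transfer_operator f \<phi>))"

text \<open>
  Set functions are made \<^term>\<open>extensional\<close> so that distinct ones differ on some Borel subset of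
  the unit interval.
\<close>

definition fa_prob_measures :: "(real set \<Rightarrow> real) set" where
  "fa_prob_measures = {\<mu> \<in> extensional (sets unit_borel).
     (\<forall>A\<in>sets unit_borel. 0 \<le> \<mu> A) \<and> additive (sets unit_borel) \<mu> \<and> \<mu> {0..1} = 1}"

text \<open>
  For a bounded Borel integrand and a finitely additive probability measure, the supremum over
  simple functions from below agrees with the common limit of the integrals of any sequence of
  simple functions converging uniformly to the integrand.
\<close>

definition fa_simple_integral :: "(real set \<Rightarrow> real) \<Rightarrow> (real \<Rightarrow> real) \<Rightarrow> real" where
  "fa_simple_integral \<mu> s = (\<Sum>c\<in>s ` {0..1}. c * \<mu> (s -` {c} \<inter> {0..1}))"

definition fa_integral :: "(real set \<Rightarrow> real) \<Rightarrow> (real \<Rightarrow> real) \<Rightarrow> real" where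
  "fa_integral \<mu> \<psi> =
     (SUP s\<in>{s. simple_function unit_borel s \<and> (\<forall>x\<in>{0..1}. s x \<le> \<psi> x)}. fa_simple_integral \<mu> s)"

definition tangent_functionals ::
    "(real \<Rightarrow> real) \<Rightarrow> (real \<Rightarrow> real) \<Rightarrow> (real set \<Rightarrow> real) set" where
  "tangent_functionals f \<phi> = {\<mu> \<in> fa_prob_measures. \<forall>\<psi>\<in>bounded_borel.
     pressure f (\<lambda>x. \<phi> x + \<psi> x) - pressure f \<phi> \<ge> fa_integral \<mu> \<psi>}"

text \<open>
  The space \<open>V\<close> of directions is a parameter, and the base point need not belong to it: the
  geometric potential jumps at \<open>1/2\<close>, so differentiability there along the continuous functions
  refers to the pressure on the translate of \<^const>\<open>continuous_functions\<close> by that potential.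
\<close>

definition gateaux_differentiable_at ::
    "(real \<Rightarrow> real) set \<Rightarrow> ((real \<Rightarrow> real) \<Rightarrow> real) \<Rightarrow> (real \<Rightarrow> real) \<Rightarrow> bool" where
  "gateaux_differentiable_at V \<Gamma> \<phi> \<longleftrightarrow>
     (\<forall>\<psi>\<in>V. \<exists>L. ((\<lambda>t. (\<Gamma> (\<lambda>x. \<phi> x + t * \<psi> x) - \<Gamma> \<phi>) / t) \<longlongrightarrow> L) (at 0))"

end

theory Submission
  imports Defs
begin

text \<open>
  The pressure is the exponential growth rate of the iterates of \<open>1\<close> under the transfer operator, and
  everything rests on how orbits behave near the neutral fixed point \<open>0\<close>, where the geometric potential
  vanishes.

  Lower bounds come from single backward orbits: the limit of the averages of a potential along
  such an orbit never exceeds its pressure (\<open>pressure_ge_orbit\<close>). The constant orbit at \<open>0\<close> and the backward orbit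
  of \<open>1/2\<close> along the left branch both attain the pressure \<open>0\<close> of the geometric potential. Hence every
  cluster point of the empirical measures of either is a tangent functional
  (\<open>tangent_functional_of_orbit\<close>). The first gives the point mass at \<open>0\<close>. The second is a finitely
  additive measure concentrated on punctured neighbourhoods of \<open>0\<close>; it differs from the first on the
  set \<open>{0}\<close>. In the direction of the indicator of \<open>{0}\<close> the pressure therefore has a corner.

  Continuous functions do not separate the two functionals, and the derivative in
  a continuous direction \<open>\<psi>\<close> is \<open>\<psi> 0\<close>. The lower bound is again the fixed point. For the upper bound,
  a coboundary (\<open>pressure_compare\<close>) reduces the claim to one family of potentials: if the
  geometric potential is raised by \<open>s\<close> on the right half \<open>[1/2,1]\<close>, then the pressure is \<open>o(s)\<close> as \<open>s\<close>
  decreases to \<open>0\<close> (\<open>pressure_right_biased_small\<close>). Here \<open>\<alpha> \<ge> 1\<close> enters: Lebesgue-typical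
  mass spends an infinite mean time near \<open>0\<close> between visits to the right half, so the bias acts with
  frequency zero. To make this quantitative, the iterates are kept in a cone of decreasing functions \<open>u\<close>
  with \<open>x powr (1 + \<alpha>) * u x\<close> increasing, which bounds the distortion on the right half. The
  total mass then satisfies a renewal inequality whose kernel is the sequence of preimages of
  \<open>1\<close> under the left branch; the kernel is not summable, and \<open>renewal_growth_bound\<close> turns this into the
  growth bound.
\<close>

section \<open>Pressure of bounded potentials\<close>

text \<open>
  Fekete's lemma: write \<open>n = q m + r\<close> with \<open>r < m\<close>. Subadditivity bounds \<open>a n\<close> by \<open>q\<close> copies of \<open>a m\<close> and
  a remainder that is negligible after division by \<open>n\<close>, so every \<open>a m / m\<close> bounds the upper limit.
\<close>

lemma fekete:
  fixes a :: "nat \<Rightarrow> real"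
  assumes sub: "\<And>m n. a (m + n) \<le> a m + a n" and lower: "\<And>n. - B * real n \<le> a n"
  obtains L where "(\<lambda>n. a n / real n) \<longlonglongrightarrow> L" and "\<And>n. n > 0 \<Longrightarrow> L \<le> a n / real n"
proof -
  define L where "L = (INF n\<in>{1..}. a n / real n)"
  have bdd: "bdd_below ((\<lambda>n. a n / real n) ` {1..})"
  proof (rule bdd_belowI2)
    fix n :: nat assume "n \<in> {1..}"
    then show "- B \<le> a n / real n" using lower[of n] by (simp add: field_simps)
  qed
  have L_le: "L \<le> a n / real n" if "n > 0" for n
    unfolding L_def using that by (intro cINF_lower[OF bdd]) auto
  have mult: "a (q * m + r) \<le> real q * a m + a r" for q m r
  proof (induction q)
    case (Suc q)
    have "a (Suc q * m + r) = a (m + (q * m + r))" by (simp add: add.assoc)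
    also have "\<dots> \<le> a m + (real q * a m + a r)" using sub[of m "q * m + r"] Suc by linarith
    finally show ?case by (simp add: algebra_simps)
  qed simp
  have bound: "\<exists>C. \<forall>n>0. a n / real n \<le> a m / real m + C / real n" if "m > 0" for m
  proof -
    define M where "M = Max ((\<lambda>r. \<bar>a r\<bar>) ` {..<m})"
    have M: "a r \<le> M" if "r < m" for r
    proof -
      have "\<bar>a r\<bar> \<le> M" unfolding M_def using that by (intro Max_ge) auto
      then show ?thesis by linarith
    qed
    have "a n / real n \<le> a m / real m + (\<bar>a m\<bar> + M) / real n" if "n > 0" for n
    proof -
      define q r where "q = n div m" and "r = n mod m"
      have n: "n = q * m + r" and r: "r < m" using \<open>m > 0\<close> by (auto simp: q_def r_def)
      have "real q = (real n - real r) / real m" using n \<open>m > 0\<close> by (simp add: field_simps)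
      then have "real q * a m = real n * (a m / real m) - (real r / real m) * a m"
        using \<open>m > 0\<close> by (simp add: diff_divide_distrib left_diff_distrib)
      moreover have "- ((real r / real m) * a m) \<le> \<bar>a m\<bar>"
      proof -
        have "- ((real r / real m) * a m) \<le> \<bar>(real r / real m) * a m\<bar>" by (rule abs_ge_minus_self)
        also have "\<dots> = (real r / real m) * \<bar>a m\<bar>" by (simp add: abs_mult)
        also have "\<dots> \<le> 1 * \<bar>a m\<bar>" using r by (intro mult_right_mono) auto
        finally show ?thesis by simp
      qed
      moreover have "a n \<le> real q * a m + M"
        using mult[of q m r] M[OF r] by (simp flip: n)
      ultimately have "a n \<le> real n * (a m / real m) + (\<bar>a m\<bar> + M)" by linarith
      then have "a n / real n \<le> (real n * (a m / real m) + (\<bar>a m\<bar> + M)) / real n"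
        by (intro divide_right_mono) auto
      with that show ?thesis by (simp add: add_divide_distrib)
    qed
    then show ?thesis by blast
  qed
  have "(\<lambda>n. a n / real n) \<longlonglongrightarrow> L"
  proof (rule order_tendstoI)
    fix y assume "y < L"
    then show "\<forall>\<^sub>F n in sequentially. y < a n / real n"
      using eventually_gt_at_top[of "0::nat"] by (elim eventually_mono) (rule less_le_trans[OF _ L_le])
  next
    fix y assume "L < y"
    then have "\<exists>m\<in>{1::nat..}. a m / real m < y"
      unfolding L_def by (subst (asm) cINF_less_iff[OF _ bdd]) auto
    then obtain m :: nat where "m \<in> {1..}" and m: "a m / real m < y" by blast
    then have "m > 0" by simp
    obtain C where C: "\<And>n. n > 0 \<Longrightarrow> a n / real n \<le> a m / real m + C / real n"
      using bound[OF \<open>m > 0\<close>] by blast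
    have "(\<lambda>n. a m / real m + C / real n) \<longlonglongrightarrow> a m / real m + 0"
      by (intro tendsto_intros lim_const_over_n)
    then have "\<forall>\<^sub>F n in sequentially. a m / real m + C / real n < y"
      using m by (intro order_tendstoD) auto
    then show "\<forall>\<^sub>F n in sequentially. a n / real n < y"
      using eventually_gt_at_top[of "0::nat"] by eventually_elim (rule le_less_trans[OF C])
  qed
  with L_le that show thesis by blast
qed

locale finite_fibre_map =
  fixes f :: "real \<Rightarrow> real" and d :: nat
  assumes finite_fibre: "\<And>x. x \<in> {0..1} \<Longrightarrow> finite {y. y \<in> {0..1} \<and> f y = x}"
    and fibre_nonempty: "\<And>x. x \<in> {0..1} \<Longrightarrow> {y. y \<in> {0..1} \<and> f y = x} \<noteq> {}"
    and card_fibre: "\<And>x. x \<in> {0..1} \<Longrightarrow> card {y. y \<in> {0..1} \<and> f y = x} \<le> d"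
begin

abbreviation iterate_one :: "(real \<Rightarrow> real) \<Rightarrow> nat \<Rightarrow> real \<Rightarrow> real" where
  "iterate_one \<phi> n \<equiv> (transfer_operator f \<phi> ^^ n) (\<lambda>_. 1)"

abbreviation growth :: "(real \<Rightarrow> real) \<Rightarrow> nat \<Rightarrow> real" where
  "growth \<phi> n \<equiv> sup_norm (iterate_one \<phi> n)"

lemma transfer_mono:
  assumes "\<And>y. y \<in> {0..1} \<Longrightarrow> g y \<le> h y"
  shows "transfer_operator f \<phi> g x \<le> transfer_operator f \<phi> h x"
  unfolding transfer_operator_def using assms by (intro sum_mono mult_left_mono) auto

lemma transfer_scale: "transfer_operator f \<phi> (\<lambda>y. c * g y) x = c * transfer_operator f \<phi> g x"
  unfolding transfer_operator_def by (simp add: sum_distrib_left algebra_simps)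

lemma transfer_abs: "\<bar>transfer_operator f \<phi> g x\<bar> \<le> transfer_operator f \<phi> (\<lambda>y. \<bar>g y\<bar>) x"
proof -
  have "\<bar>transfer_operator f \<phi> g x\<bar> \<le> (\<Sum>y | y \<in> {0..1} \<and> f y = x. \<bar>exp (\<phi> y) * g y\<bar>)"
    unfolding transfer_operator_def by (rule sum_abs)
  then show ?thesis by (simp add: transfer_operator_def abs_mult)
qed

lemma transfer_ge_term:
  assumes "y \<in> {0..1}" "f y \<in> {0..1}" "\<And>z. z \<in> {0..1} \<Longrightarrow> 0 \<le> g z"
  shows "exp (\<phi> y) * g y \<le> transfer_operator f \<phi> g (f y)"
  unfolding transfer_operator_def
  by (rule member_le_sum) (use assms finite_fibre[OF assms(2)] in auto)

lemma iterate_abs_le: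
  assumes "\<And>y. y \<in> {0..1} \<Longrightarrow> \<bar>g y\<bar> \<le> C" "x \<in> {0..1}"
  shows "\<bar>(transfer_operator f \<phi> ^^ n) g x\<bar> \<le> C * iterate_one \<phi> n x"
  using assms(2)
proof (induction n arbitrary: x)
  case (Suc n)
  have "\<bar>(transfer_operator f \<phi> ^^ Suc n) g x\<bar>
      \<le> transfer_operator f \<phi> (\<lambda>y. \<bar>(transfer_operator f \<phi> ^^ n) g y\<bar>) x"
    by (simp add: transfer_abs)
  also have "\<dots> \<le> transfer_operator f \<phi> (\<lambda>y. C * iterate_one \<phi> n y) x"
    by (intro transfer_mono Suc.IH)
  finally show ?case by (simp add: transfer_scale)
qed (use assms in simp)

lemma iterate_one_lower:
  assumes "\<And>y. y \<in> {0..1} \<Longrightarrow> - B \<le> \<phi> y" "x \<in> {0..1}"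
  shows "exp (- B * real n) \<le> iterate_one \<phi> n x"
  using assms(2)
proof (induction n arbitrary: x)
  case (Suc n)
  obtain y where y: "y \<in> {0..1}" "f y = x" using fibre_nonempty[OF Suc.prems] by blast
  have nonneg: "0 \<le> iterate_one \<phi> n z" if "z \<in> {0..1}" for z
    using Suc.IH[OF that] by (meson exp_ge_zero order_trans)
  have "exp (- B * real (Suc n)) = exp (- B) * exp (- B * real n)"
    by (simp add: algebra_simps flip: exp_add)
  also have "\<dots> \<le> exp (\<phi> y) * iterate_one \<phi> n y"
    using Suc.IH[OF y(1)] assms(1)[OF y(1)] by (intro mult_mono) auto
  also have "\<dots> \<le> iterate_one \<phi> (Suc n) x"
    using transfer_ge_term[of y "iterate_one \<phi> n" \<phi>] y Suc.prems nonneg by simp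
  finally show ?case .
qed simp

lemma iterate_one_upper:
  assumes "\<And>y. y \<in> {0..1} \<Longrightarrow> \<phi> y \<le> B" "x \<in> {0..1}"
  shows "iterate_one \<phi> n x \<le> (real d * exp B) ^ n"
  using assms(2)
proof (induction n arbitrary: x)
  case (Suc n)
  have "iterate_one \<phi> (Suc n) x \<le> transfer_operator f \<phi> (\<lambda>y. (real d * exp B) ^ n) x"
    unfolding funpow.simps comp_def by (intro transfer_mono Suc.IH)
  also have "\<dots> \<le> (\<Sum>y | y \<in> {0..1} \<and> f y = x. exp B * (real d * exp B) ^ n)"
    unfolding transfer_operator_def using assms(1) by (intro sum_mono mult_right_mono) auto
  also have "\<dots> \<le> real d * (exp B * (real d * exp B) ^ n)"
    using card_fibre[OF Suc.prems] by (auto intro!: mult_right_mono)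
  finally show ?case by (simp add: algebra_simps)
qed simp

end

text \<open>
  For a bounded potential the iterates of the constant \<open>1\<close> are bounded above and bounded away from
  \<open>0\<close>. Their suprema are submultiplicative, which makes the limit in the spectral radius exist and
  turns each finite iterate into an upper bound for the pressure.
\<close>

locale bounded_potential = finite_fibre_map +
  fixes \<phi> :: "real \<Rightarrow> real"
  assumes potential_bounded: "bounded (\<phi> ` {0..1})"
begin

lemma potential_bound: obtains B where "\<And>y. y \<in> {0..1} \<Longrightarrow> \<bar>\<phi> y\<bar> \<le> B"
proof -
  obtain B where "\<forall>x\<in>\<phi> ` {0..1}. norm x \<le> B" using potential_bounded unfolding bounded_iff by blast
  then show thesis by (intro that[of B]) auto
qed

lemma iterate_one_pos: "x \<in> {0..1} \<Longrightarrow> 0 < iterate_one \<phi> n x"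
proof -
  assume x: "x \<in> {0..1}"
  obtain B where "\<And>y. y \<in> {0..1} \<Longrightarrow> \<bar>\<phi> y\<bar> \<le> B" by (rule potential_bound) blast
  then have "- B \<le> \<phi> y" if "y \<in> {0..1}" for y using that by (auto simp: abs_le_iff minus_le_iff)
  from iterate_one_lower[where \<phi> = \<phi> and n = n, OF this x] show ?thesis by (meson exp_gt_zero less_le_trans)
qed

lemma bdd_above_iterate_one: "bdd_above ((\<lambda>x. \<bar>iterate_one \<phi> n x\<bar>) ` {0..1})"
proof -
  obtain B where "\<And>y. y \<in> {0..1} \<Longrightarrow> \<bar>\<phi> y\<bar> \<le> B" by (rule potential_bound) blast
  then have "\<phi> y \<le> B" if "y \<in> {0..1}" for y using that by (auto simp: abs_le_iff minus_le_iff)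
  from iterate_one_upper[where \<phi> = \<phi>, OF this] show ?thesis
    by (intro bdd_aboveI2[of _ _ "(real d * exp B) ^ n"]) (simp add: iterate_one_pos less_imp_le)
qed

lemma iterate_one_le_growth: "x \<in> {0..1} \<Longrightarrow> iterate_one \<phi> n x \<le> growth \<phi> n"
  unfolding sup_norm_def
  using cSUP_upper[OF _ bdd_above_iterate_one[of n], of x] iterate_one_pos[of x n] by simp

lemma growth_leI:
  assumes "\<And>x. x \<in> {0..1} \<Longrightarrow> iterate_one \<phi> n x \<le> C"
  shows "growth \<phi> n \<le> C"
  unfolding sup_norm_def
proof (intro cSUP_least)
  fix x :: real assume "x \<in> {0..1}"
  then show "\<bar>iterate_one \<phi> n x\<bar> \<le> C" using assms[of x] iterate_one_pos[of x n] by simp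
qed simp

lemma growth_pos: "0 < growth \<phi> n"
  using iterate_one_le_growth[of 0 n] iterate_one_pos[of 0 n] by simp

text \<open>
  Because the operator is positive, the constant function \<open>1\<close> realises the supremum that defines
  the operator norm of every power, so the spectral radius is read off from the iterates of \<open>1\<close>.
\<close>

lemma operator_norm_eq_growth: "operator_norm (transfer_operator f \<phi> ^^ n) = growth \<phi> n"
proof -
  let ?U = "{\<psi> \<in> bounded_borel. sup_norm \<psi> \<le> 1}"
  have one: "(\<lambda>_. 1) \<in> ?U" by (auto simp: bounded_borel_def sup_norm_def bounded_iff)
  have le: "sup_norm ((transfer_operator f \<phi> ^^ n) \<psi>) \<le> growth \<phi> n" if \<psi>: "\<psi> \<in> ?U" for \<psi>
  proof -
    have "bdd_above ((\<lambda>x. \<bar>\<psi> x\<bar>) ` {0..1})"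
      using \<psi> by (auto simp: bounded_borel_def bounded_iff bdd_above_def)
    then have "\<bar>\<psi> y\<bar> \<le> 1" if "y \<in> {0..1}" for y
      using \<psi> cSUP_upper[of y "{0..1}" "\<lambda>x. \<bar>\<psi> x\<bar>"] that unfolding sup_norm_def by simp
    then have abs_le: "\<bar>(transfer_operator f \<phi> ^^ n) \<psi> x\<bar> \<le> 1 * iterate_one \<phi> n x" if "x \<in> {0..1}" for x
      using that by (intro iterate_abs_le)
    show ?thesis unfolding sup_norm_def[of "(transfer_operator f \<phi> ^^ n) \<psi>"]
    proof (intro cSUP_least)
      fix x :: real assume "x \<in> {0..1}"
      then show "\<bar>(transfer_operator f \<phi> ^^ n) \<psi> x\<bar> \<le> growth \<phi> n"
        using abs_le[of x] iterate_one_le_growth[of x n] by simp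
    qed simp
  qed
  show ?thesis unfolding operator_norm_def
  proof (rule antisym)
    show "(SUP \<psi>\<in>?U. sup_norm ((transfer_operator f \<phi> ^^ n) \<psi>)) \<le> growth \<phi> n"
      using one le by (intro cSUP_least) auto
    show "growth \<phi> n \<le> (SUP \<psi>\<in>?U. sup_norm ((transfer_operator f \<phi> ^^ n) \<psi>))"
      using le by (intro cSUP_upper2[OF _ one]) (auto intro!: bdd_aboveI2)
  qed
qed

lemma growth_add_le: "growth \<phi> (m + n) \<le> growth \<phi> m * growth \<phi> n"
proof (rule growth_leI)
  fix x :: real assume x: "x \<in> {0..1}"
  have "iterate_one \<phi> (m + n) x = (transfer_operator f \<phi> ^^ m) (iterate_one \<phi> n) x"
    by (simp add: funpow_add)
  also have "\<dots> \<le> growth \<phi> n * iterate_one \<phi> m x"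
  proof -
    have "\<bar>iterate_one \<phi> n y\<bar> \<le> growth \<phi> n" if "y \<in> {0..1}" for y
      using iterate_one_le_growth[OF that, of n] iterate_one_pos[OF that, of n] by simp
    from iterate_abs_le[where g = "iterate_one \<phi> n" and \<phi> = \<phi> and n = m, OF this x] show ?thesis by simp
  qed
  also have "\<dots> \<le> growth \<phi> n * growth \<phi> m"
    using growth_pos[of n] iterate_one_le_growth[OF x] by (intro mult_left_mono) auto
  finally show "iterate_one \<phi> (m + n) x \<le> growth \<phi> m * growth \<phi> n" by (simp add: mult.commute)
qed

lemma pressure_limit: "(\<lambda>n. ln (growth \<phi> n) / real n) \<longlonglongrightarrow> pressure f \<phi>"
  and pressure_le_growth: "n > 0 \<Longrightarrow> pressure f \<phi> \<le> ln (growth \<phi> n) / real n"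
proof -
  obtain B where "\<And>y. y \<in> {0..1} \<Longrightarrow> \<bar>\<phi> y\<bar> \<le> B" by (rule potential_bound) blast
  then have B: "- B \<le> \<phi> y" if "y \<in> {0..1}" for y using that by (auto simp: abs_le_iff minus_le_iff)
  have "- B * real n \<le> ln (growth \<phi> n)" for n
    using iterate_one_lower[where \<phi> = \<phi> and x = 0 and n = n, OF B] iterate_one_le_growth[of 0 n] growth_pos[of n]
    by (simp add: ln_ge_iff)
  moreover have "ln (growth \<phi> (m + n)) \<le> ln (growth \<phi> m) + ln (growth \<phi> n)" for m n
    using growth_add_le[of m n] growth_pos by (simp flip: ln_mult_pos)
  ultimately obtain L where L: "(\<lambda>n. ln (growth \<phi> n) / real n) \<longlonglongrightarrow> L"
      "\<And>n. n > 0 \<Longrightarrow> L \<le> ln (growth \<phi> n) / real n"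
    using fekete[of "\<lambda>n. ln (growth \<phi> n)" B] by blast
  have "(\<lambda>n. exp (ln (growth \<phi> n) / real n)) \<longlonglongrightarrow> exp L" by (intro tendsto_intros L)
  then have "(\<lambda>n. root n (growth \<phi> n)) \<longlonglongrightarrow> exp L"
  proof (rule Lim_transform_eventually)
    show "\<forall>\<^sub>F n in sequentially. exp (ln (growth \<phi> n) / real n) = root n (growth \<phi> n)"
      using eventually_gt_at_top[of "0::nat"]
    proof eventually_elim
      case (elim n)
      then show ?case using growth_pos[of n] by (simp add: root_powr_inverse powr_def)
    qed
  qed
  then have "spectral_radius (transfer_operator f \<phi>) = exp L"
    unfolding spectral_radius_def operator_norm_eq_growth by (rule limI)
  then have "pressure f \<phi> = L" by (simp add: pressure_def)
  with L show "(\<lambda>n. ln (growth \<phi> n) / real n) \<longlonglongrightarrow> pressure f \<phi>"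
    and "n > 0 \<Longrightarrow> pressure f \<phi> \<le> ln (growth \<phi> n) / real n" by auto
qed

lemma exp_pressure_power_le_growth: "exp (pressure f \<phi>) ^ n \<le> growth \<phi> n"
proof (cases "n = 0")
  case True
  then show ?thesis using iterate_one_le_growth[of 0 0] by simp
next
  case False
  then have "real n * pressure f \<phi> \<le> ln (growth \<phi> n)"
    using pressure_le_growth[of n] by (simp add: field_simps)
  then show ?thesis using growth_pos[of n]
    by (metis exp_le_cancel_iff exp_ln exp_of_nat_mult)
qed

text \<open>Only the term of the given orbit segment is kept in the sum over all preimages.\<close>

lemma growth_ge_orbit:
  assumes orbit: "\<And>k. y k \<in> {0..1}" "\<And>k. f (y (Suc k)) = y k"
  shows "exp (\<Sum>k=1..n. \<phi> (y k)) \<le> growth \<phi> n"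
proof -
  have "exp (\<Sum>k=1..n. \<phi> (y k)) \<le> iterate_one \<phi> n (y 0)"
    using orbit
  proof (induction n arbitrary: y)
    case (Suc n)
    have nonneg: "0 \<le> iterate_one \<phi> n z" if "z \<in> {0..1}" for z
      using iterate_one_pos[OF that, of n] by simp
    have "(\<Sum>k=1..Suc n. \<phi> (y k)) = \<phi> (y 1) + (\<Sum>k=1..n. \<phi> (y (Suc k)))"
      using sum.atLeast_Suc_atMost[of 1 "Suc n" "\<lambda>k. \<phi> (y k)"]
        sum.shift_bounds_cl_Suc_ivl[of "\<lambda>k. \<phi> (y k)" 1 n]
      by (simp del: sum.cl_ivl_Suc)
    then have "exp (\<Sum>k=1..Suc n. \<phi> (y k)) = exp (\<phi> (y 1)) * exp (\<Sum>k=1..n. \<phi> (y (Suc k)))"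
      by (simp add: exp_add)
    also have "\<dots> \<le> exp (\<phi> (y 1)) * iterate_one \<phi> n (y 1)"
      using Suc.IH[of "\<lambda>k. y (Suc k)"] Suc.prems by simp
    also have "\<dots> \<le> iterate_one \<phi> (Suc n) (y 0)"
    proof -
      have "f (y 1) = y 0" using Suc.prems(2)[of 0] by simp
      then show ?thesis
        using transfer_ge_term[of "y 1" "iterate_one \<phi> n" \<phi>] Suc.prems(1) nonneg by simp
    qed
    finally show ?case .
  qed simp
  also have "\<dots> \<le> growth \<phi> n" using orbit by (intro iterate_one_le_growth)
  finally show ?thesis .
qed

lemma pressure_ge_orbit:
  assumes orbit: "\<And>k. y k \<in> {0..1}" "\<And>k. f (y (Suc k)) = y k"
    and G: "G \<noteq> bot" "G \<le> sequentially"
    and lim: "(h \<longlongrightarrow> c) G"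
    and ev: "\<forall>\<^sub>F n in G. h n \<le> (\<Sum>k=1..n. \<phi> (y k)) / real n"
  shows "c \<le> pressure f \<phi>"
proof (rule tendsto_le[OF G(1) _ lim])
  show "((\<lambda>n. ln (growth \<phi> n) / real n) \<longlongrightarrow> pressure f \<phi>) G"
    by (rule tendsto_mono[OF G(2) pressure_limit])
  have "(\<Sum>k=1..n. \<phi> (y k)) / real n \<le> ln (growth \<phi> n) / real n" for n
    using growth_ge_orbit[where y = y and n = n, OF orbit] growth_pos[of n]
    by (intro divide_right_mono) (simp_all add: ln_ge_iff)
  with ev show "\<forall>\<^sub>F n in G. h n \<le> ln (growth \<phi> n) / real n"
    by (auto elim!: eventually_mono intro: order_trans)
qed

end

text \<open>
  Adding a bounded coboundary \<open>w \<circ> f - w\<close> conjugates the transfer operator by multiplication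
  with \<open>exp w\<close>, which distorts norms by a bounded factor only.
\<close>

lemma pressure_compare:
  assumes "bounded_potential f d \<phi>" "bounded_potential f d \<eta>"
    and le: "\<And>y. y \<in> {0..1} \<Longrightarrow> f y \<in> {0..1} \<Longrightarrow> \<phi> y \<le> \<eta> y + c + w (f y) - w y"
    and W: "\<And>y. y \<in> {0..1} \<Longrightarrow> \<bar>w y\<bar> \<le> W"
  shows "pressure f \<phi> \<le> pressure f \<eta> + c"
proof -
  interpret \<phi>: bounded_potential f d \<phi> by fact
  interpret \<eta>: bounded_potential f d \<eta> by fact
  have conj: "(transfer_operator f \<phi> ^^ n) (\<lambda>_. 1) x
      \<le> exp (real n * c + w x) * (transfer_operator f \<eta> ^^ n) (\<lambda>y. exp (- w y)) x"
    if "x \<in> {0..1}" for n x using that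
  proof (induction n arbitrary: x)
    case (Suc n)
    let ?g = "(transfer_operator f \<eta> ^^ n) (\<lambda>y. exp (- w y))"
    have g: "0 \<le> ?g y" if "y \<in> {0..1}" for y
    proof -
      have "0 < exp (real n * c + w y) * ?g y"
        using Suc.IH[OF that] \<phi>.iterate_one_pos[OF that, of n] by linarith
      then show ?thesis by (simp add: zero_less_mult_iff)
    qed
    have "(transfer_operator f \<phi> ^^ Suc n) (\<lambda>_. 1) x
        \<le> transfer_operator f \<phi> (\<lambda>y. exp (real n * c + w y) * ?g y) x"
      unfolding funpow.simps comp_def by (intro \<phi>.transfer_mono Suc.IH)
    also have "\<dots> \<le> (\<Sum>y | y \<in> {0..1} \<and> f y = x.
        exp (real (Suc n) * c + w x) * (exp (\<eta> y) * ?g y))"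
    proof -
      have "exp (\<phi> y) * (exp (real n * c + w y) * ?g y)
          \<le> exp (real (Suc n) * c + w x) * (exp (\<eta> y) * ?g y)"
        if y: "y \<in> {0..1}" "f y = x" for y
      proof -
        have "exp (\<phi> y) * exp (real n * c + w y) \<le> exp (real (Suc n) * c + w x) * exp (\<eta> y)"
          using le[of y] y Suc.prems by (simp add: algebra_simps flip: exp_add)
        then have "exp (\<phi> y) * exp (real n * c + w y) * ?g y
            \<le> exp (real (Suc n) * c + w x) * exp (\<eta> y) * ?g y"
          using g y by (intro mult_right_mono) auto
        then show ?thesis by (simp only: mult.assoc)
      qed
      then show ?thesis
        unfolding transfer_operator_def[of f \<phi> _ x] by (auto simp only: mem_Collect_eq intro: sum_mono)
    qed
    also have "\<dots> = exp (real (Suc n) * c + w x) * (transfer_operator f \<eta> ^^ Suc n) (\<lambda>y. exp (- w y)) x"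
      unfolding funpow.simps comp_def transfer_operator_def[of f \<eta> _ x] sum_distrib_left ..
    finally show ?case .
  qed (simp flip: exp_add)
  have growth: "\<phi>.growth \<phi> n \<le> exp (real n * c + 2 * W) * \<phi>.growth \<eta> n" for n
  proof (rule \<phi>.growth_leI)
    fix x :: real assume x: "x \<in> {0..1}"
    have "\<bar>exp (- w y)\<bar> \<le> exp W" if "y \<in> {0..1}" for y using W[OF that] by auto
    from \<phi>.iterate_abs_le[where g = "\<lambda>y. exp (- w y)" and \<phi> = \<eta> and n = n, OF this x]
    have "(transfer_operator f \<eta> ^^ n) (\<lambda>y. exp (- w y)) x \<le> exp W * \<phi>.iterate_one \<eta> n x"
      by linarith
    also have "\<dots> \<le> exp W * \<phi>.growth \<eta> n"
      by (intro mult_left_mono \<eta>.iterate_one_le_growth x) simp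
    finally have "(transfer_operator f \<eta> ^^ n) (\<lambda>y. exp (- w y)) x \<le> exp W * \<phi>.growth \<eta> n" .
    then have "exp (real n * c + w x) * (transfer_operator f \<eta> ^^ n) (\<lambda>y. exp (- w y)) x
        \<le> exp (real n * c + w x) * (exp W * \<phi>.growth \<eta> n)" by simp
    also have "\<dots> \<le> exp (real n * c + W) * (exp W * \<phi>.growth \<eta> n)"
      using W[OF x] \<eta>.growth_pos[of n] by (intro mult_right_mono) auto
    also have "\<dots> = exp (real n * c + 2 * W) * \<phi>.growth \<eta> n"
      by (simp add: algebra_simps flip: exp_add)
    finally show "(transfer_operator f \<phi> ^^ n) (\<lambda>_. 1) x \<le> exp (real n * c + 2 * W) * \<phi>.growth \<eta> n"
      using conj[OF x, of n] by linarith
  qed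
  have "ln (\<phi>.growth \<phi> n) \<le> real n * c + 2 * W + ln (\<phi>.growth \<eta> n)" for n
  proof -
    have "ln (\<phi>.growth \<phi> n) \<le> ln (exp (real n * c + 2 * W) * \<phi>.growth \<eta> n)"
      using growth[of n] \<phi>.growth_pos[of n] by (simp add: ln_mono)
    then show ?thesis using \<eta>.growth_pos[of n] by (simp add: ln_mult)
  qed
  then have ev: "\<forall>\<^sub>F n in sequentially. ln (\<phi>.growth \<phi> n) / real n
      \<le> c + 2 * W / real n + ln (\<phi>.growth \<eta> n) / real n"
    using eventually_gt_at_top[of "0::nat"]
  proof (elim eventually_mono)
    fix n :: nat
    assume n: "0 < n" and le: "\<And>n. ln (\<phi>.growth \<phi> n) \<le> real n * c + 2 * W + ln (\<phi>.growth \<eta> n)"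
    have "ln (\<phi>.growth \<phi> n) / real n \<le> (real n * c + 2 * W + ln (\<phi>.growth \<eta> n)) / real n"
      by (intro divide_right_mono le) simp
    with n show "ln (\<phi>.growth \<phi> n) / real n \<le> c + 2 * W / real n + ln (\<phi>.growth \<eta> n) / real n"
      by (simp add: add_divide_distrib)
  qed
  have "(\<lambda>n. c + 2 * W / real n + ln (\<phi>.growth \<eta> n) / real n) \<longlonglongrightarrow> c + 0 + pressure f \<eta>"
    by (intro tendsto_intros lim_const_over_n \<eta>.pressure_limit)
  from tendsto_le[OF trivial_limit_sequentially this \<phi>.pressure_limit ev] show ?thesis by simp
qed

section \<open>Tangent functionals from backward orbits\<close>

text \<open>
  This is Tychonoff's theorem for \<open>[0,1]\<close>-valued functions. A cluster point is the limit along a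
  filter finer than \<^const>\<open>sequentially\<close>, although no subsequence need converge.
\<close>

lemma pointwise_cluster_point:
  fixes M :: "nat \<Rightarrow> 'a \<Rightarrow> real"
  assumes range: "\<And>n A. M n A \<in> {0..1}"
  obtains G \<mu> where "G \<noteq> bot" and "G \<le> sequentially" and "\<And>A. ((\<lambda>n. M n A) \<longlongrightarrow> \<mu> A) G"
proof -
  let ?K = "Pi\<^sub>E UNIV (\<lambda>_::'a. {0..1::real})"
  have "compactin (product_topology (\<lambda>_::'a. euclidean) UNIV) ?K"
    unfolding compactin_PiE by simp
  then have "compact ?K" by (simp add: euclidean_product_topology)
  moreover have "\<forall>\<^sub>F x in filtermap M sequentially. x \<in> ?K"
    using range by (simp add: eventually_filtermap PiE_iff)
  ultimately obtain \<mu> where \<mu>: "inf (nhds \<mu>) (filtermap M sequentially) \<noteq> bot"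
    unfolding compact_filter by (metis filtermap_bot_iff trivial_limit_sequentially)
  define G where "G = inf sequentially (filtercomap M (nhds \<mu>))"
  have "G \<noteq> bot"
  proof
    assume "G = bot"
    then have "\<forall>\<^sub>F n in G. False" by simp
    then obtain P Q where P: "eventually P sequentially" and Q: "eventually Q (filtercomap M (nhds \<mu>))"
        and PQ: "\<And>n. P n \<Longrightarrow> Q n \<Longrightarrow> False"
      unfolding G_def eventually_inf by auto
    obtain R where R: "eventually R (nhds \<mu>)" "\<And>n. R (M n) \<Longrightarrow> Q n"
      using Q unfolding eventually_filtercomap by auto
    have "eventually (\<lambda>x. \<not> R x) (filtermap M sequentially)"
      using P unfolding eventually_filtermap by (rule eventually_mono) (use PQ R in blast)
    with R(1) have "\<forall>\<^sub>F x in inf (nhds \<mu>) (filtermap M sequentially). False"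
      unfolding eventually_inf by blast
    with \<mu> show False by (simp add: eventually_False)
  qed
  moreover have "(M \<longlongrightarrow> \<mu>) G"
    unfolding filterlim_def filtermap_le_iff_le_filtercomap G_def by simp
  then have "((\<lambda>n. M n A) \<longlongrightarrow> \<mu> A) G" for A
    using continuous_on_tendsto_compose[OF continuous_on_product_coordinates, of M \<mu> G A] by simp
  moreover have "G \<le> sequentially" by (simp add: G_def)
  ultimately show thesis using that by blast
qed

definition empirical_measure :: "(nat \<Rightarrow> real) \<Rightarrow> nat \<Rightarrow> real set \<Rightarrow> real" where
  "empirical_measure y n A = (\<Sum>k=1..n. indicator A (y k)) / real n"

lemma empirical_measure_range: "empirical_measure y n A \<in> {0..1}"
proof -
  have "(\<Sum>k=1..n. indicator A (y k)) \<le> (\<Sum>k=1..n. 1::real)"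
    by (intro sum_mono) (simp add: indicator_def)
  then show ?thesis
    by (auto simp: empirical_measure_def sum_nonneg divide_le_eq)
qed

lemma empirical_simple_integral:
  assumes "\<And>k. y k \<in> {0..1}" and "finite (s ` {0..1})"
  shows "(\<Sum>c\<in>s ` {0..1}. c * empirical_measure y n (s -` {c} \<inter> {0..1})) = (\<Sum>k=1..n. s (y k)) / real n"
proof -
  have point: "(\<Sum>c\<in>s ` {0..1}. c * indicator (s -` {c} \<inter> {0..1}) (y k)) = s (y k)" for k
  proof -
    have "(\<Sum>c\<in>s ` {0..1}. c * indicator (s -` {c} \<inter> {0..1}) (y k))
        = (\<Sum>c\<in>s ` {0..1}. if s (y k) = c then c else 0)"
      using assms(1)[of k] by (intro sum.cong) (auto simp: indicator_def)
    also have "\<dots> = s (y k)" using assms by simp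
    finally show ?thesis .
  qed
  have "(\<Sum>c\<in>s ` {0..1}. c * empirical_measure y n (s -` {c} \<inter> {0..1}))
      = (\<Sum>c\<in>s ` {0..1}. \<Sum>k=1..n. c * indicator (s -` {c} \<inter> {0..1}) (y k)) / real n"
    by (simp only: empirical_measure_def sum_distrib_left sum_divide_distrib times_divide_eq_right)
  also have "\<dots> = (\<Sum>k=1..n. s (y k)) / real n"
    by (subst sum.swap) (simp only: point)
  finally show ?thesis .
qed

text \<open>
  If the empirical measures of a backward orbit converge to \<open>\<mu>\<close> and the averages of \<open>\<phi>\<close> along it
  reach the pressure, then the orbit bounds the pressure of every perturbation \<open>\<phi> + \<psi>\<close> from below by
  the limit of its averages of \<open>\<phi> + \<psi>\<close>, which is \<open>pressure f \<phi> + \<integral>\<psi> d\<mu>\<close>.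
\<close>

lemma (in bounded_potential) tangent_functional_of_orbit:
  assumes orbit: "\<And>k. y k \<in> {0..1}" "\<And>k. f (y (Suc k)) = y k"
    and G: "G \<noteq> bot" "G \<le> sequentially"
    and lim: "\<And>A. ((\<lambda>n. empirical_measure y n A) \<longlongrightarrow> \<mu> A) G"
    and h: "(h \<longlongrightarrow> pressure f \<phi>) G" "\<And>n. h n \<le> (\<Sum>k=1..n. \<phi> (y k)) / real n"
  shows "restrict \<mu> (sets unit_borel) \<in> tangent_functionals f \<phi>"
proof -
  let ?\<mu> = "restrict \<mu> (sets unit_borel)"
  have space: "space unit_borel = {0..1}" by (simp add: space_restrict_space)
  have pos: "\<forall>\<^sub>F n in G. n > 0" using G(2) eventually_gt_at_top[of "0::nat"] by (rule filter_leD)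
  have add: "\<mu> (A \<union> B) = \<mu> A + \<mu> B" if "A \<inter> B = {}" for A B
  proof (rule tendsto_unique[OF G(1) lim])
    have "empirical_measure y n (A \<union> B) = empirical_measure y n A + empirical_measure y n B" for n
      using that by (simp add: empirical_measure_def indicator_add[symmetric] sum.distrib
          add_divide_distrib)
    then show "((\<lambda>n. empirical_measure y n (A \<union> B)) \<longlongrightarrow> \<mu> A + \<mu> B) G"
      by (simp add: tendsto_add lim)
  qed
  have "((\<lambda>n. empirical_measure y n {0..1}) \<longlongrightarrow> 1) G"
  proof (rule tendsto_eventually)
    show "\<forall>\<^sub>F n in G. empirical_measure y n {0..1} = 1"
      using pos by eventually_elim (use orbit(1) in \<open>simp add: empirical_measure_def\<close>)
  qed
  then have one: "\<mu> {0..1} = 1" using tendsto_unique[OF G(1) lim] by blast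
  have nonneg: "0 \<le> \<mu> A" for A
    by (rule tendsto_lowerbound[OF lim _ G(1)]) (use empirical_measure_range in auto)
  have "{0..1} \<in> sets unit_borel" using sets.top[of unit_borel] by (simp only: space)
  then have prob: "?\<mu> \<in> fa_prob_measures"
    using nonneg one unfolding fa_prob_measures_def additive_def by (auto simp: add sets.Un)
  have "fa_integral ?\<mu> \<psi> \<le> pressure f (\<lambda>x. \<phi> x + \<psi> x) - pressure f \<phi>"
    if \<psi>: "\<psi> \<in> bounded_borel" for \<psi>
  proof -
    have bounded: "bounded (\<psi> ` {0..1})" using \<psi> by (simp add: bounded_borel_def)
    interpret \<psi>: bounded_potential f d "\<lambda>x. \<phi> x + \<psi> x"
    proof
      show "bounded ((\<lambda>x. \<phi> x + \<psi> x) ` {0..1})"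
        by (intro bounded_plus_comp potential_bounded bounded)
    qed
    obtain B where B: "\<And>x. x \<in> {0..1} \<Longrightarrow> - B \<le> \<psi> x"
    proof -
      obtain B where B: "\<forall>z\<in>\<psi> ` {0..1}. norm z \<le> B" using bounded unfolding bounded_iff by blast
      have "- B \<le> \<psi> x" if "x \<in> {0..1}" for x using B that by (auto simp: abs_le_iff minus_le_iff)
      then show thesis by (rule that)
    qed
    show ?thesis unfolding fa_integral_def
    proof (rule cSUP_least)
      show "{s. simple_function unit_borel s \<and> (\<forall>x\<in>{0..1}. s x \<le> \<psi> x)} \<noteq> {}"
        using B by (auto intro!: exI[of _ "\<lambda>_. - B"])
    next
      fix s assume "s \<in> {s. simple_function unit_borel s \<and> (\<forall>x\<in>{0..1}. s x \<le> \<psi> x)}"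
      then have s: "simple_function unit_borel s" and le: "\<And>x. x \<in> {0..1} \<Longrightarrow> s x \<le> \<psi> x" by auto
      have fin: "finite (s ` {0..1})" using simple_functionD(1)[OF s] by (simp only: space)
      have meas: "s -` {c} \<inter> {0..1} \<in> sets unit_borel" for c
        using simple_functionD(2)[OF s, of "{c}"] by (simp only: space)
      have "((\<lambda>n. h n + (\<Sum>c\<in>s ` {0..1}. c * empirical_measure y n (s -` {c} \<inter> {0..1})))
          \<longlongrightarrow> pressure f \<phi> + (\<Sum>c\<in>s ` {0..1}. c * \<mu> (s -` {c} \<inter> {0..1}))) G"
        by (intro tendsto_intros h lim)
      moreover have "\<forall>\<^sub>F n in G. h n + (\<Sum>c\<in>s ` {0..1}. c * empirical_measure y n (s -` {c} \<inter> {0..1}))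
          \<le> (\<Sum>k=1..n. \<phi> (y k) + \<psi> (y k)) / real n"
      proof (intro always_eventually allI)
        fix n
        have "(\<Sum>k=1..n. s (y k)) / real n \<le> (\<Sum>k=1..n. \<psi> (y k)) / real n"
          by (intro divide_right_mono sum_mono le orbit) simp
        then show "h n + (\<Sum>c\<in>s ` {0..1}. c * empirical_measure y n (s -` {c} \<inter> {0..1}))
          \<le> (\<Sum>k=1..n. \<phi> (y k) + \<psi> (y k)) / real n"
          using h(2)[of n] by (simp add: empirical_simple_integral[OF orbit(1) fin] sum.distrib add_divide_distrib)
      qed
      ultimately have "pressure f \<phi> + (\<Sum>c\<in>s ` {0..1}. c * \<mu> (s -` {c} \<inter> {0..1}))
          \<le> pressure f (\<lambda>x. \<phi> x + \<psi> x)"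
        by (intro \<psi>.pressure_ge_orbit[where y = y and G = G] orbit G)
      then show "fa_simple_integral ?\<mu> s \<le> pressure f (\<lambda>x. \<phi> x + \<psi> x) - pressure f \<phi>"
        by (simp add: fa_simple_integral_def meas)
    qed
  qed
  with prob show ?thesis by (auto simp: tangent_functionals_def)
qed

section \<open>A renewal inequality\<close>

text \<open>
  A renewal argument with generating functions. For \<open>z < 1/\<rho>\<close> let \<open>V\<close> be the generating function of
  \<open>v\<close>. The convolution bound reads \<open>c * H * V * (1 - z) \<le> 1 + \<sigma> * V\<close>, where \<open>H\<close> is the generating
  function of \<open>A\<close>, so \<open>V\<close> stays bounded as long as \<open>c * H * (1 - z)\<close> exceeds \<open>\<sigma>\<close>. On the other hand
  the growth assumption forces \<open>V\<close> to blow up as \<open>z\<close> increases to \<open>1/\<rho>\<close>. At \<open>z = 1/\<rho>\<close> the first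
  alternative must therefore fail; truncating \<open>H\<close> to its first \<open>m\<close> terms gives the stated form.
\<close>

lemma renewal_growth_bound:
  fixes v A :: "nat \<Rightarrow> real"
  assumes v: "\<And>k. 0 \<le> v k" and A: "\<And>j. 0 \<le> A j" "\<And>j. A j \<le> 1"
    and c: "0 \<le> c" and \<sigma>: "0 \<le> \<sigma>" and \<tau>: "0 \<le> \<tau>" and \<rho>: "1 < \<rho>"
    and conv: "\<And>n. c * (\<Sum>j\<le>n. A j * v (n - j)) \<le> 1 + \<sigma> * (\<Sum>k\<le>n. v k)"
    and growth: "\<And>n. \<rho> ^ Suc n \<le> 1 + \<tau> * (\<Sum>k\<le>n. v k)"
    and summable: "\<And>z. 0 < z \<Longrightarrow> z < 1 / \<rho> \<Longrightarrow> summable (\<lambda>k. z ^ k * v k)"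
  shows "c * (\<Sum>j<m. A j) * (1 - 1 / \<rho>) \<le> \<sigma> * \<rho> ^ m"
proof -
  define W where "W = (\<Sum>j<m. A j)"
  \<comment> \<open>\<open>Q z > 0\<close> is what makes the convolution bound control \<open>V\<close>, namely by \<open>1 / Q z\<close>.\<close>
  define Q where "Q z = c * W * z ^ m * (1 - z) - \<sigma>" for z :: real
  have W: "0 \<le> W" unfolding W_def by (intro sum_nonneg A)
  have resolvent: "\<rho> * (1 - z) * Q z \<le> (Q z + \<tau>) * (1 - z * \<rho>)"
    if z: "0 < z" "z < 1 / \<rho>" and Q: "0 < Q z" for z
  proof -
    have z1: "z < 1" using z \<rho> by (smt (verit) divide_less_eq_1)
    have z\<rho>: "0 < z * \<rho>" "z * \<rho> < 1" using z \<rho> by (simp_all add: field_simps)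
    define V where "V = (\<Sum>k. z ^ k * v k)"
    define H where "H = (\<Sum>j. z ^ j * A j)"
    have sv: "summable (\<lambda>k. norm (z ^ k * v k))" using summable[OF z] z v by simp
    have sz: "summable (\<lambda>k. norm (z ^ k))" using z z1 by (simp add: summable_geometric)
    have sA: "summable (\<lambda>k. norm (z ^ k * A k))"
      by (rule summable_comparison_test[OF _ sz])
        (use A z in \<open>auto intro!: exI[of _ 0] mult_left_le simp: abs_mult\<close>)
    have V: "0 \<le> V" unfolding V_def using summable[OF z] z v by (intro suminf_nonneg) auto
    have geo: "(\<lambda>n. z ^ n) sums (1 / (1 - z))" using z z1 by (intro geometric_sums) simp
    have s1: "(\<lambda>n. z ^ n * (\<Sum>k\<le>n. v k)) sums (1 / (1 - z) * V)"
    proof -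
      have "(\<Sum>i\<le>n. z ^ i * (z ^ (n - i) * v (n - i))) = z ^ n * (\<Sum>k\<le>n. v k)" for n
      proof -
        have "(\<Sum>i\<le>n. z ^ i * (z ^ (n - i) * v (n - i))) = (\<Sum>i\<le>n. z ^ n * v (n - i))"
          by (intro sum.cong refl) (simp flip: mult.assoc power_add)
        also have "\<dots> = z ^ n * (\<Sum>i\<le>n. v (n - i))" by (simp add: sum_distrib_left)
        also have "(\<Sum>i\<le>n. v (n - i)) = (\<Sum>k\<le>n. v k)"
          using sum.atLeastAtMost_rev[of v 0 n] by (simp add: atLeast0AtMost)
        finally show ?thesis .
      qed
      with Cauchy_product_sums[OF sz sv] show ?thesis
        using sums_unique[OF geo] by (simp add: V_def)
    qed
    have s2: "(\<lambda>n. z ^ n * (\<Sum>j\<le>n. A j * v (n - j))) sums (H * V)"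
    proof -
      have "(\<Sum>i\<le>n. (z ^ i * A i) * (z ^ (n - i) * v (n - i))) = z ^ n * (\<Sum>j\<le>n. A j * v (n - j))" for n
      proof -
        have "(z ^ i * A i) * (z ^ (n - i) * v (n - i)) = z ^ n * (A i * v (n - i))" if "i \<le> n" for i
        proof -
          have "z ^ n = z ^ i * z ^ (n - i)" using that by (simp flip: power_add)
          then show ?thesis by simp
        qed
        then show ?thesis unfolding sum_distrib_left by (intro sum.cong) auto
      qed
      with Cauchy_product_sums[OF sA sv] show ?thesis by (simp add: V_def H_def)
    qed
    have "c * (H * V) \<le> 1 / (1 - z) + \<sigma> * (1 / (1 - z) * V)"
    proof (rule sums_le[OF _ sums_mult[OF s2] sums_add[OF geo sums_mult[OF s1]]])
      fix n
      have "z ^ n * (c * (\<Sum>j\<le>n. A j * v (n - j))) \<le> z ^ n * (1 + \<sigma> * (\<Sum>k\<le>n. v k))"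
        using z by (intro mult_left_mono conv) simp
      then show "c * (z ^ n * (\<Sum>j\<le>n. A j * v (n - j))) \<le> z ^ n + \<sigma> * (z ^ n * (\<Sum>k\<le>n. v k))"
        by (simp add: algebra_simps)
    qed
    then have upper: "c * H * V * (1 - z) \<le> 1 + \<sigma> * V" using z1 by (simp add: field_simps)
    have "W * z ^ m \<le> H"
    proof -
      have "W * z ^ m = (\<Sum>j<m. z ^ m * A j)" by (simp add: W_def sum_distrib_left mult.commute)
      also have "\<dots> \<le> (\<Sum>j<m. z ^ j * A j)"
        using z z1 A by (intro sum_mono mult_right_mono power_decreasing) auto
      also have "\<dots> \<le> H" unfolding H_def
        using sA A z by (intro sum_le_suminf) auto
      finally show ?thesis .
    qed
    then have "c * (W * z ^ m) * V * (1 - z) \<le> c * H * V * (1 - z)"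
      using c V z1 by (intro mult_right_mono mult_left_mono) auto
    with upper have VQ: "V * Q z \<le> 1" by (simp add: Q_def algebra_simps)
    have "\<rho> * (1 / (1 - z * \<rho>)) \<le> 1 / (1 - z) + \<tau> * (1 / (1 - z) * V)"
    proof (rule sums_le[OF _ sums_mult[OF geometric_sums] sums_add[OF geo sums_mult[OF s1]]])
      fix n
      have "z ^ n * \<rho> ^ Suc n \<le> z ^ n * (1 + \<tau> * (\<Sum>k\<le>n. v k))"
        using z by (intro mult_left_mono growth) simp
      then show "\<rho> * (z * \<rho>) ^ n \<le> z ^ n + \<tau> * (z ^ n * (\<Sum>k\<le>n. v k))"
        by (simp add: algebra_simps)
    qed (use z\<rho> in simp)
    also have "1 / (1 - z) + \<tau> * (1 / (1 - z) * V) = (1 + \<tau> * V) / (1 - z)"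
      by (simp add: add_divide_distrib)
    finally have "\<rho> * (1 - z) \<le> (1 + \<tau> * V) * (1 - z * \<rho>)" using z1 z\<rho> by (simp add: field_simps)
    then have "\<rho> * (1 - z) * Q z \<le> (1 + \<tau> * V) * (1 - z * \<rho>) * Q z"
      using Q by (intro mult_right_mono) auto
    also have "\<dots> = (Q z + \<tau> * (V * Q z)) * (1 - z * \<rho>)" by (simp add: algebra_simps)
    also have "\<dots> \<le> (Q z + \<tau> * 1) * (1 - z * \<rho>)"
      using VQ \<tau> z\<rho> by (intro mult_right_mono add_left_mono mult_left_mono) auto
    finally show ?thesis by simp
  qed
  have "Q (1 / \<rho>) \<le> 0"
  proof (rule ccontr)
    assume "\<not> Q (1 / \<rho>) \<le> 0"
    then have pos: "0 < Q (1 / \<rho>)" by simp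
    have Q_lim: "(Q \<longlongrightarrow> Q (1 / \<rho>)) (at_left (1 / \<rho>))"
      unfolding Q_def by (intro tendsto_intros)
    have "\<forall>\<^sub>F z in at_left (1 / \<rho>). 0 < Q z" using order_tendstoD(1)[OF Q_lim pos] .
    moreover have "\<forall>\<^sub>F z in at_left (1 / \<rho>). z \<in> {0<..<1 / \<rho>}"
      using \<rho> by (intro eventually_at_left_real) simp
    ultimately have ev: "\<forall>\<^sub>F z in at_left (1 / \<rho>). \<rho> * (1 - z) * Q z \<le> (Q z + \<tau>) * (1 - z * \<rho>)"
      by eventually_elim (use resolvent in auto)
    have "\<rho> * (1 - 1 / \<rho>) * Q (1 / \<rho>) \<le> (Q (1 / \<rho>) + \<tau>) * (1 - 1 / \<rho> * \<rho>)"
    proof (rule tendsto_le[OF _ _ _ ev])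
      show "((\<lambda>z. (Q z + \<tau>) * (1 - z * \<rho>)) \<longlongrightarrow> (Q (1 / \<rho>) + \<tau>) * (1 - 1 / \<rho> * \<rho>)) (at_left (1 / \<rho>))"
        by (intro tendsto_intros Q_lim)
      show "((\<lambda>z. \<rho> * (1 - z) * Q z) \<longlongrightarrow> \<rho> * (1 - 1 / \<rho>) * Q (1 / \<rho>)) (at_left (1 / \<rho>))"
        by (intro tendsto_intros Q_lim)
    qed simp
    then have "(\<rho> - 1) * Q (1 / \<rho>) \<le> 0" using \<rho> by (simp add: algebra_simps)
    with pos \<rho> show False by (simp add: mult_le_0_iff)
  qed
  then have "c * W * (1 - 1 / \<rho>) * (1 / \<rho>) ^ m \<le> \<sigma>" by (simp add: Q_def algebra_simps)
  then show ?thesis using \<rho> by (simp add: W_def power_one_over field_simps)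
qed

section \<open>The left branch and its inverse\<close>

text \<open>
  The logarithmic derivative of the ratio is \<open>p/(1 + t) - p/(1 + p t)\<close>, which is nonnegative.
\<close>

lemma powr_ratio_mono:
  fixes p :: real
  assumes p: "1 \<le> p" and "0 \<le> s" "s \<le> t"
  shows "(1 + s) powr p / (1 + p * s) \<le> (1 + t) powr p / (1 + p * t)"
proof -
  let ?k = "\<lambda>t. p * ln (1 + t) - ln (1 + p * t)"
  have "?k s \<le> ?k t"
  proof (rule DERIV_nonneg_imp_nondecreasing[OF \<open>s \<le> t\<close>])
    fix x assume "s \<le> x"
    with \<open>0 \<le> s\<close> have x: "0 \<le> x" by simp
    have px: "0 < 1 + p * x" using x p by (intro add_pos_nonneg) auto
    have "(?k has_real_derivative p * (1 / (1 + x)) - p / (1 + p * x)) (at x)"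
      using x px by (auto intro!: derivative_eq_intros)
    moreover have "p / (1 + p * x) \<le> p * (1 / (1 + x))"
      using x p px mult_right_mono[OF p x] by (auto intro!: divide_left_mono)
    ultimately show "\<exists>y. (?k has_real_derivative y) (at x) \<and> 0 \<le> y" by force
  qed
  moreover have "exp (?k x) = (1 + x) powr p / (1 + p * x)" if "0 \<le> x" for x
  proof -
    have "0 < 1 + p * x" using that p by (intro add_pos_nonneg) auto
    then show ?thesis using that by (simp add: exp_diff powr_def)
  qed
  moreover have "0 \<le> t" using assms by simp
  ultimately show ?thesis using \<open>0 \<le> s\<close> by (metis exp_le_cancel_iff)
qed

lemma one_plus_mult_le_powr:
  fixes p :: real
  assumes "1 \<le> p" "0 \<le> t"
  shows "1 + p * t \<le> (1 + t) powr p"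
proof -
  have "0 < 1 + p * t" using assms by (intro add_pos_nonneg) auto
  then show ?thesis using powr_ratio_mono[of p 0 t] assms by (simp add: field_simps)
qed

locale manneville_pomeau =
  fixes \<alpha> :: real
  assumes \<alpha>: "1 \<le> \<alpha>"
begin

text \<open>
  \<open>q y = (2 y) powr \<alpha>\<close> is the relative displacement of the left branch.
\<close>

definition q :: "real \<Rightarrow> real" where "q y = 2 powr \<alpha> * y powr \<alpha>"

definition left_map :: "real \<Rightarrow> real" where "left_map y = y * (1 + q y)"

definition left_slope :: "real \<Rightarrow> real" where "left_slope y = 1 + (1 + \<alpha>) * q y"

definition left_inv :: "real \<Rightarrow> real" where "left_inv = the_inv_into {0..1/2} left_map"

lemma q_nonneg [simp]: "0 \<le> q y" by (simp add: q_def)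

lemma q_0 [simp]: "q 0 = 0" by (simp add: q_def)

lemma q_half [simp]: "q (1/2) = 1"
  unfolding q_def by (simp flip: powr_mult)

lemma q_mono: "0 \<le> x \<Longrightarrow> x \<le> y \<Longrightarrow> q x \<le> q y"
  using \<alpha> by (auto simp: q_def intro!: mult_left_mono powr_mono2)

lemma q_le_linear: "0 \<le> y \<Longrightarrow> y \<le> 1/2 \<Longrightarrow> q y \<le> 2 * y"
proof -
  assume y: "0 \<le> y" "y \<le> 1/2"
  have "q y = (2 * y) powr \<alpha>" using y by (simp add: q_def powr_mult)
  also have "\<dots> \<le> (2 * y) powr 1" using y \<alpha> by (intro powr_mono') auto
  finally show ?thesis using y by simp
qed

lemma left_slope_ge_1: "1 \<le> left_slope y"
  using \<alpha> by (simp add: left_slope_def)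

lemma left_slope_mono: "0 \<le> x \<Longrightarrow> x \<le> y \<Longrightarrow> left_slope x \<le> left_slope y"
  using \<alpha> by (auto simp: left_slope_def intro!: mult_left_mono q_mono)

text \<open>Convexity of the left branch, in the form of Young's inequality for the exponent \<open>1 + \<alpha>\<close>.\<close>

lemma left_map_above_tangent:
  assumes "0 \<le> x" "0 \<le> y"
  shows "left_slope x * (y - x) \<le> left_map y - left_map x"
proof -
  have "y * x powr \<alpha> \<le> y powr (1 + \<alpha>) / (1 + \<alpha>) + (x powr \<alpha>) powr ((1 + \<alpha>) / \<alpha>) / ((1 + \<alpha>) / \<alpha>)"
    using \<alpha> assms by (intro Youngs_inequality) (auto simp: field_simps)
  also have "(x powr \<alpha>) powr ((1 + \<alpha>) / \<alpha>) = x powr (1 + \<alpha>)" using \<alpha> by (simp add: powr_powr)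
  also have "y powr (1 + \<alpha>) / (1 + \<alpha>) + x powr (1 + \<alpha>) / ((1 + \<alpha>) / \<alpha>)
      = (y powr (1 + \<alpha>) + \<alpha> * x powr (1 + \<alpha>)) / (1 + \<alpha>)"
  proof -
    have "x powr (1 + \<alpha>) / ((1 + \<alpha>) / \<alpha>) = \<alpha> * x powr (1 + \<alpha>) / (1 + \<alpha>)"
      by (simp add: mult.commute)
    then show ?thesis by (simp only: add_divide_distrib)
  qed
  finally have "(1 + \<alpha>) * (y * x powr \<alpha>) \<le> y powr (1 + \<alpha>) + \<alpha> * x powr (1 + \<alpha>)"
    using \<alpha> by (simp add: pos_le_divide_eq mult.commute)
  moreover have "x powr (1 + \<alpha>) = x * x powr \<alpha>" "y powr (1 + \<alpha>) = y * y powr \<alpha>"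
    using assms by (auto simp: powr_add)
  ultimately have "0 \<le> 2 powr \<alpha> * (y * y powr \<alpha> + \<alpha> * (x * x powr \<alpha>) - (1 + \<alpha>) * (y * x powr \<alpha>))"
    by simp
  then show ?thesis by (simp add: left_slope_def left_map_def q_def algebra_simps)
qed

lemma left_map_strict_mono: "0 \<le> x \<Longrightarrow> x < y \<Longrightarrow> left_map x < left_map y"
proof -
  assume xy: "0 \<le> x" "x < y"
  have "0 < left_slope x * (y - x)" using xy left_slope_ge_1[of x] by (intro mult_pos_pos) auto
  then show ?thesis using left_map_above_tangent[of x y] xy by linarith
qed

lemma left_map_0 [simp]: "left_map 0 = 0" and left_map_half [simp]: "left_map (1/2) = 1"
  using q_half by (simp_all add: left_map_def)

lemma left_inv_unique: "0 \<le> y \<Longrightarrow> y \<le> 1/2 \<Longrightarrow> left_inv (left_map y) = y"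
proof -
  assume y: "0 \<le> y" "y \<le> 1/2"
  have "inj_on left_map {0..1/2}"
    by (rule linorder_inj_onI) (use left_map_strict_mono in force)+
  from the_inv_into_f_f[OF this, of y] y show ?thesis by (simp add: left_inv_def)
qed

lemma left_inv:
  assumes "x \<in> {0..1}"
  shows left_inv_ge_0: "0 \<le> left_inv x" and left_inv_le_half: "left_inv x \<le> 1/2"
    and left_map_left_inv: "left_map (left_inv x) = x"
proof -
  have "continuous_on {0..1/2} left_map"
    unfolding left_map_def q_def using \<alpha> by (intro continuous_intros continuous_on_powr') auto
  then obtain y where "0 \<le> y" "y \<le> 1/2" "left_map y = x"
    using IVT'[of left_map 0 x "1/2"] assms by auto
  with left_inv_unique[of y] show "0 \<le> left_inv x" "left_inv x \<le> 1/2" "left_map (left_inv x) = x"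
    by auto
qed

lemma left_inv_mem: "x \<in> {0..1} \<Longrightarrow> left_inv x \<in> {0..1}"
  using left_inv[of x] by simp

lemma left_inv_0 [simp]: "left_inv 0 = 0" and left_inv_1 [simp]: "left_inv 1 = 1/2"
  using left_inv_unique[of 0] left_inv_unique[of "1/2"] by simp_all

lemma left_inv_less_half: "0 \<le> x \<Longrightarrow> x < 1 \<Longrightarrow> left_inv x < 1/2"
  using left_inv[of x] left_map_half by (metis atLeastAtMost_iff less_eq_real_def less_irrefl)

lemma left_inv_mono:
  assumes "0 \<le> x" "x \<le> y" "y \<le> 1"
  shows "left_inv x \<le> left_inv y"
proof (rule ccontr)
  assume "\<not> left_inv x \<le> left_inv y"
  then have "left_map (left_inv y) < left_map (left_inv x)"
    using left_inv_ge_0[of y] assms by (intro left_map_strict_mono) auto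
  with assms show False using left_map_left_inv[of x] left_map_left_inv[of y] by simp
qed

lemma left_inv_above_tangent:
  assumes "x \<in> {0..1}" "y \<in> {0..1}"
  shows "left_slope (left_inv x) * (left_inv y - left_inv x) \<le> y - x"
  using left_map_above_tangent[of "left_inv x" "left_inv y"] left_inv[OF assms(1)] left_inv[OF assms(2)]
  by simp

lemma left_inv_factor:
  assumes "x \<in> {0..1}"
  shows "x = left_inv x * (1 + q (left_inv x))"
  using left_map_left_inv[OF assms] by (simp add: left_map_def)

text \<open>
  The successive preimages of \<open>1\<close> under the left branch decrease to the neutral fixed point \<open>0\<close>.
  The assumption \<open>\<alpha> \<ge> 1\<close> makes this so slow that their sum diverges. Half of this sum is the
  Lebesgue integral of the first-return time to the right half.
\<close>

abbreviation preimage_1 :: "nat \<Rightarrow> real" where "preimage_1 j \<equiv> (left_inv ^^ j) 1"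

lemma iterate_left_inv_mem: "x \<in> {0..1} \<Longrightarrow> (left_inv ^^ j) x \<in> {0..1}"
  by (induction j) (auto simp del: atLeastAtMost_iff intro: left_inv_mem)

text \<open>
  On \<open>[0,1/2]\<close> one has \<open>q y \<le> 2 y\<close> because \<open>\<alpha> \<ge> 1\<close>, hence \<open>1/y \<le> 1/x + 2\<close> for \<open>y = left_inv x\<close>.
\<close>

lemma preimage_1_ge: "1 / (1 + 2 * real j) \<le> preimage_1 j"
proof (induction j)
  case (Suc j)
  let ?x = "preimage_1 j" and ?y = "preimage_1 (Suc j)"
  have x: "?x \<in> {0..1}" and y: "0 \<le> ?y" "?y \<le> 1/2"
    using iterate_left_inv_mem[of 1 j] left_inv[of "preimage_1 j"] by auto
  have pos: "0 < 1 / (1 + 2 * real j)" by simp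
  have fac: "?x = ?y * (1 + q ?y)" using left_inv_factor[OF x] by simp
  moreover have "?y * (1 + q ?y) \<le> ?y * (1 + 2 * ?y)"
    by (intro mult_left_mono add_left_mono q_le_linear y)
  ultimately have "?x \<le> ?y * (1 + 2 * ?y)" by linarith
  also have "\<dots> \<le> ?y * (1 + 2 * ?x)"
  proof -
    have "?y * 1 \<le> ?y * (1 + q ?y)" using y by (intro mult_left_mono) auto
    then have "?y \<le> ?x" using fac by linarith
    then show ?thesis using y by (intro mult_left_mono) auto
  qed
  finally have "?x \<le> ?y * (1 + 2 * ?x)" .
  then have "?x / (1 + 2 * ?x) \<le> ?y" using x by (simp add: field_simps)
  moreover have "1 / (1 + 2 * real (Suc j)) \<le> ?x / (1 + 2 * ?x)"
  proof -
    have "1 \<le> ?x * (1 + 2 * real j)" using Suc pos by (simp add: field_simps)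
    then show ?thesis using x by (simp add: field_simps)
  qed
  ultimately show ?case by linarith
qed simp

lemma preimage_1_pos: "0 < preimage_1 j"
proof -
  have "0 < 1 / (1 + 2 * real j)" by simp
  then show ?thesis using preimage_1_ge[of j] by linarith
qed

lemma sum_preimage_1_unbounded: "\<exists>m. C \<le> (\<Sum>j<m. preimage_1 j)"
proof (rule ccontr)
  assume "\<nexists>m. C \<le> (\<Sum>j<m. preimage_1 j)"
  then have "(\<Sum>j<m. preimage_1 j) \<le> C" for m by (meson linear)
  then have "summable preimage_1"
    using preimage_1_pos by (intro summableI_nonneg_bounded[of _ C]) (auto intro: less_imp_le)
  then have "summable (\<lambda>j. 2 * preimage_1 j)" by (rule summable_mult)
  then have "summable (\<lambda>j. inverse (real (Suc j)))"
  proof (rule summable_comparison_test[rotated], intro exI allI impI)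
    fix j :: nat
    have "inverse (real (Suc j)) \<le> 2 * (1 / (1 + 2 * real j))" by (simp add: field_simps)
    also have "\<dots> \<le> 2 * preimage_1 j" using preimage_1_ge[of j] by simp
    finally show "norm (inverse (real (Suc j))) \<le> 2 * preimage_1 j" by simp
  qed
  with not_summable_harmonic[where ?'a = real] show False
    using summable_Suc_iff[of "\<lambda>n. inverse (real n)"] by simp
qed

section \<open>Iterated densities with a biased right branch\<close>

text \<open>
  \<open>density s n\<close> is the \<open>n\<close>-th iterate of \<open>1\<close> under the transfer operator of the geometric potential
  raised by \<open>s\<close> on the right half. Both branches are used at every point: the map itself
  has no left preimage of \<open>1\<close>, but with it the iterates become continuous at \<open>1\<close> and change nowhere else.
\<close>

primrec density :: "real \<Rightarrow> nat \<Rightarrow> real \<Rightarrow> real" where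
  "density s 0 x = 1"
| "density s (Suc n) x = density s n (left_inv x) / left_slope (left_inv x)
     + exp s / 2 * density s n ((x + 1) / 2)"

text \<open>
  \<open>mass s n x\<close> is the integral of \<open>density s n\<close> over \<open>[0,x]\<close>. Changing variables in the two branches
  turns the recursion for the densities into this one. Since the densities are decreasing, all that
  is needed of the integral is its comparison with the density at the endpoints of an interval.
\<close>

primrec mass :: "real \<Rightarrow> nat \<Rightarrow> real \<Rightarrow> real" where
  "mass s 0 x = x"
| "mass s (Suc n) x = mass s n (left_inv x) + exp s * (mass s n ((x + 1) / 2) - mass s n (1/2))"

lemma density_nonneg: "0 \<le> density s n x"
proof (induction n arbitrary: x)
  case (Suc n)
  have "0 \<le> left_slope (left_inv x)" using left_slope_ge_1[of "left_inv x"] by linarith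
  with Suc show ?case by simp
qed simp

lemma density_antimono:
  assumes "0 \<le> x" "x \<le> y" "y \<le> 1"
  shows "density s n y \<le> density s n x"
  using assms
proof (induction n arbitrary: x y)
  case (Suc n)
  have "density s n (left_inv y) / left_slope (left_inv y) \<le> density s n (left_inv x) / left_slope (left_inv x)"
  proof (rule frac_le)
    show "density s n (left_inv y) \<le> density s n (left_inv x)"
      using Suc.prems left_inv[of x] left_inv[of y] left_inv_mono[of x y] by (intro Suc.IH) auto
    show "left_slope (left_inv x) \<le> left_slope (left_inv y)"
      using Suc.prems left_inv[of x] left_inv_mono[of x y] by (intro left_slope_mono) auto
    show "0 < left_slope (left_inv x)" using left_slope_ge_1[of "left_inv x"] by linarith
  qed (rule density_nonneg)
  moreover have "density s n ((y + 1) / 2) \<le> density s n ((x + 1) / 2)"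
    using Suc.prems by (intro Suc.IH) auto
  ultimately show ?case by (auto intro!: add_mono)
qed simp

text \<open>
  Together with monotonicity this confines the densities to a cone: on the right half they
  vary at most by the factor \<open>2 powr (1 + \<alpha>)\<close>, for all \<open>n\<close> and \<open>s\<close>. The left branch preserves the cone
  since \<open>x = a * (1 + q a)\<close> for \<open>a = left_inv x\<close>, so that the weight \<open>1 / left_slope a\<close> turns into the ratio
  in \<open>powr_ratio_mono\<close>.
\<close>

lemma density_powr_mono:
  assumes "0 \<le> x" "x \<le> y" "y \<le> 1"
  shows "x powr (1 + \<alpha>) * density s n x \<le> y powr (1 + \<alpha>) * density s n y"
  using assms
proof (induction n arbitrary: x y)
  case 0
  then show ?case using \<alpha> by (auto intro: powr_mono2)
next
  case (Suc n)
  let ?p = "1 + \<alpha>"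
  have left: "z powr ?p * (density s n (left_inv z) / left_slope (left_inv z))
      = (left_inv z powr ?p * density s n (left_inv z))
        * ((1 + q (left_inv z)) powr ?p / (1 + ?p * q (left_inv z)))" if "z \<in> {0..1}" for z
  proof -
    have "z powr ?p = left_inv z powr ?p * (1 + q (left_inv z)) powr ?p"
      using left_inv_factor[OF that] left_inv_ge_0[OF that]
      by (metis add_nonneg_nonneg powr_mult q_nonneg zero_le_one)
    then show ?thesis by (simp add: left_slope_def)
  qed
  have right: "z powr ?p * (exp s / 2 * density s n ((z + 1) / 2))
      = (((z + 1) / 2) powr ?p * density s n ((z + 1) / 2)) * ((2 * z / (z + 1)) powr ?p * (exp s / 2))"
    if "0 \<le> z" for z
  proof -
    have "z = (z + 1) / 2 * (2 * z / (z + 1))" using that by (simp add: field_simps)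
    then have "z powr ?p = ((z + 1) / 2) powr ?p * (2 * z / (z + 1)) powr ?p"
      using that by (metis add_nonneg_nonneg divide_nonneg_nonneg mult_nonneg_nonneg powr_mult
          zero_le_numeral zero_le_one)
    then show ?thesis by simp
  qed
  have "x powr ?p * (density s n (left_inv x) / left_slope (left_inv x))
      \<le> y powr ?p * (density s n (left_inv y) / left_slope (left_inv y))"
  proof -
    have "(1 + q (left_inv x)) powr ?p / (1 + ?p * q (left_inv x))
        \<le> (1 + q (left_inv y)) powr ?p / (1 + ?p * q (left_inv y))"
      using Suc.prems \<alpha> left_inv[of x] left_inv_mono[of x y]
      by (intro powr_ratio_mono q_mono) auto
    moreover have "left_inv x powr ?p * density s n (left_inv x) \<le> left_inv y powr ?p * density s n (left_inv y)"
      using Suc.prems left_inv[of x] left_inv[of y] left_inv_mono[of x y] by (intro Suc.IH) auto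
    moreover have "0 \<le> (1 + q (left_inv x)) powr ?p / (1 + ?p * q (left_inv x))"
      using \<alpha> by simp
    moreover note * = calculation
    show ?thesis
    proof -
      have "x \<in> {0..1}" "y \<in> {0..1}" using Suc.prems by auto
      then show ?thesis unfolding left[OF \<open>x \<in> {0..1}\<close>] left[OF \<open>y \<in> {0..1}\<close>]
        by (intro mult_mono mult_nonneg_nonneg density_nonneg powr_ge_zero *)
    qed
  qed
  moreover have "x powr ?p * (exp s / 2 * density s n ((x + 1) / 2))
      \<le> y powr ?p * (exp s / 2 * density s n ((y + 1) / 2))"
  proof -
    have "(2 * x / (x + 1)) powr ?p \<le> (2 * y / (y + 1)) powr ?p"
      using Suc.prems \<alpha> by (intro powr_mono2) (auto simp: field_simps)
    moreover have "((x + 1) / 2) powr ?p * density s n ((x + 1) / 2)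
        \<le> ((y + 1) / 2) powr ?p * density s n ((y + 1) / 2)"
      using Suc.prems by (intro Suc.IH) auto
    moreover note * = calculation
    show ?thesis
    proof -
      have xy: "0 \<le> x" "0 \<le> y" using Suc.prems by auto
      show ?thesis unfolding right[OF xy(1)] right[OF xy(2)]
        by (intro mult_mono mult_nonneg_nonneg density_nonneg powr_ge_zero *) simp_all
    qed
  qed
  ultimately show ?case unfolding density.simps distrib_left by (rule add_mono)
qed

text \<open>
  The induction needs no calculus: convexity of the left branch compares the increments of
  \<^const>\<open>left_inv\<close> with the slopes at both ends.
\<close>

lemma mass_bounds:
  assumes "0 \<le> x" "x \<le> y" "y \<le> 1"
  shows "(y - x) * density s n y \<le> mass s n y - mass s n x
    \<and> mass s n y - mass s n x \<le> (y - x) * density s n x"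
  using assms
proof (induction n arbitrary: x y)
  case (Suc n)
  let ?ax = "left_inv x" and ?ay = "left_inv y"
  have slope: "0 < left_slope ?ax" "0 < left_slope ?ay"
    using left_slope_ge_1[of ?ax] left_slope_ge_1[of ?ay] by linarith+
  have "(?ay - ?ax) * density s n ?ay \<le> mass s n ?ay - mass s n ?ax
      \<and> mass s n ?ay - mass s n ?ax \<le> (?ay - ?ax) * density s n ?ax"
    using Suc.prems left_inv[of x] left_inv[of y] left_inv_mono[of x y] by (intro Suc.IH) auto
  moreover have "(?ay - ?ax) * density s n ?ax \<le> ((y - x) / left_slope ?ax) * density s n ?ax"
    using left_inv_above_tangent[of x y] Suc.prems slope
    by (intro mult_right_mono density_nonneg) (auto simp: field_simps)
  moreover have "((y - x) / left_slope ?ay) * density s n ?ay \<le> (?ay - ?ax) * density s n ?ay"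
    using left_inv_above_tangent[of y x] Suc.prems slope
    by (intro mult_right_mono density_nonneg) (auto simp: field_simps)
  ultimately have left: "(y - x) * (density s n ?ay / left_slope ?ay) \<le> mass s n ?ay - mass s n ?ax"
      "mass s n ?ay - mass s n ?ax \<le> (y - x) * (density s n ?ax / left_slope ?ax)"
    by simp_all
  have IH: "((y + 1) / 2 - (x + 1) / 2) * density s n ((y + 1) / 2) \<le> mass s n ((y + 1) / 2) - mass s n ((x + 1) / 2)
      \<and> mass s n ((y + 1) / 2) - mass s n ((x + 1) / 2) \<le> ((y + 1) / 2 - (x + 1) / 2) * density s n ((x + 1) / 2)"
    using Suc.prems by (intro Suc.IH) auto
  have half: "(y + 1) / 2 - (x + 1) / 2 = (y - x) / 2" by (simp add: field_simps)
  have "exp s * (((y - x) / 2) * density s n ((y + 1) / 2)) \<le> exp s * (mass s n ((y + 1) / 2) - mass s n ((x + 1) / 2))"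
    "exp s * (mass s n ((y + 1) / 2) - mass s n ((x + 1) / 2)) \<le> exp s * (((y - x) / 2) * density s n ((x + 1) / 2))"
    using IH unfolding half by (auto intro!: mult_left_mono)
  moreover have "(y - x) * (c + exp s / 2 * d) = (y - x) * c + exp s * ((y - x) / 2 * d)" for c d
    by (simp add: algebra_simps)
  moreover have "mass s (Suc n) y - mass s (Suc n) x = (mass s n ?ay - mass s n ?ax)
      + exp s * (mass s n ((y + 1) / 2) - mass s n ((x + 1) / 2))"
    by (simp add: algebra_simps)
  ultimately show ?case using left unfolding density.simps by (simp only:) linarith
qed simp

lemma mass_0: "mass s n 0 = 0"
  by (induction n) simp_all

lemma mass_nonneg: "0 \<le> x \<Longrightarrow> x \<le> 1 \<Longrightarrow> 0 \<le> mass s n x"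
  using mass_bounds[of 0 x s n] density_nonneg[of s n x] mass_0[of s n]
  by (smt (verit) mult_nonneg_nonneg)

text \<open>
  One step of the operator preserves the mass except for the factor \<open>exp s\<close> on the right half. The
  mass there is at most half the density at \<open>1/2\<close>.
\<close>

lemma mass_total_le:
  assumes "0 \<le> s"
  shows "mass s (Suc n) 1 \<le> 1 + (exp s - 1) / 2 * (\<Sum>k\<le>n. density s k (1/2))"
proof -
  have step: "mass s (Suc n) 1 \<le> mass s n 1 + (exp s - 1) / 2 * density s n (1/2)" for n
  proof -
    have "mass s (Suc n) 1 = mass s n 1 + (exp s - 1) * (mass s n 1 - mass s n (1/2))"
      by (simp add: algebra_simps)
    also have "\<dots> \<le> mass s n 1 + (exp s - 1) * ((1 - 1/2) * density s n (1/2))"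
      using mass_bounds[of "1/2" 1 s n] assms by (intro add_left_mono mult_left_mono) auto
    finally show ?thesis by simp
  qed
  show ?thesis
  proof (induction n)
    case 0
    show ?case using step[of 0] by simp
  next
    case (Suc n)
    then show ?case using step[of "Suc n"] by (simp add: algebra_simps del: mass.simps)
  qed
qed

text \<open>
  Mass that the right branch carries into \<open>[0, (left_inv ^^ j) x]\<close> then moves along the left branch and
  fills \<open>[0,x]\<close> after \<open>j\<close> further steps. By the cone condition its density on arrival is at least a
  fixed multiple of the density at \<open>1/2\<close>. This is where the slow escape from \<open>0\<close> is felt.
\<close>

lemma mass_ge_convolution:
  assumes "0 \<le> s" "x \<in> {0..1}"
  shows "(1/2) powr (1 + \<alpha>) / 2 * (\<Sum>j\<le>n. (left_inv ^^ j) x * density s (n - j) (1/2)) \<le> mass s (Suc n) x"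
  using assms(2)
proof (induction n arbitrary: x)
  case 0
  have "(x + 1) / 2 - 1 / 2 = x / 2" by (simp add: field_simps)
  then have "mass s 1 x = left_inv x + exp s * (x / 2)" by simp
  moreover have "1 * (x / 2) \<le> exp s * (x / 2)" using assms(1) 0 by (intro mult_right_mono) auto
  moreover have "(1/2) powr (1 + \<alpha>) * (x / 2) \<le> 1 * (x / 2)"
    using \<alpha> 0 by (intro mult_right_mono) (auto intro: powr_le1)
  ultimately show ?case using left_inv_ge_0[OF 0] by (simp del: mass.simps)
next
  case (Suc n)
  let ?c = "(1/2) powr (1 + \<alpha>)" and ?b = "(x + 1) / 2"
  have b: "1/2 \<le> ?b" "?b \<le> 1" using Suc.prems by auto
  have "?c * density s (Suc n) (1/2) \<le> ?b powr (1 + \<alpha>) * density s (Suc n) ?b"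
    using b by (intro density_powr_mono) auto
  also have "\<dots> \<le> 1 * density s (Suc n) ?b"
    using b \<alpha> by (intro mult_right_mono density_nonneg powr_le1) auto
  finally have "x / 2 * (?c * density s (Suc n) (1/2)) \<le> x / 2 * density s (Suc n) ?b"
    using Suc.prems by (intro mult_left_mono) auto
  also have "\<dots> = (?b - 1/2) * density s (Suc n) ?b" by (simp add: field_simps)
  also have "\<dots> \<le> mass s (Suc n) ?b - mass s (Suc n) (1/2)"
    using mass_bounds[of "1/2" ?b s "Suc n"] b by simp
  also have "\<dots> \<le> exp s * (mass s (Suc n) ?b - mass s (Suc n) (1/2))"
  proof -
    have "0 \<le> (?b - 1/2) * density s (Suc n) ?b" using b by (intro mult_nonneg_nonneg density_nonneg) auto
    then have "0 \<le> mass s (Suc n) ?b - mass s (Suc n) (1/2)"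
      using mass_bounds[of "1/2" ?b s "Suc n"] b by linarith
    then show ?thesis using assms(1) mult_right_mono[of 1 "exp s"] by fastforce
  qed
  finally have right: "?c / 2 * (x * density s (Suc n) (1/2))
      \<le> exp s * (mass s (Suc n) ?b - mass s (Suc n) (1/2))" by (simp add: mult.commute mult.left_commute)
  have left: "?c / 2 * (\<Sum>j\<le>n. (left_inv ^^ Suc j) x * density s (n - j) (1/2)) \<le> mass s (Suc n) (left_inv x)"
    using Suc.IH[OF left_inv_mem[OF Suc.prems]] by (simp add: funpow_swap1)
  have "(\<Sum>j\<le>Suc n. (left_inv ^^ j) x * density s (Suc n - j) (1/2))
      = x * density s (Suc n) (1/2) + (\<Sum>j\<le>n. (left_inv ^^ Suc j) x * density s (n - j) (1/2))"
    by (subst sum.atMost_Suc_shift) (simp del: density.simps)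
  moreover have "mass s (Suc (Suc n)) x
      = mass s (Suc n) (left_inv x) + exp s * (mass s (Suc n) ?b - mass s (Suc n) (1/2))"
    by (rule mass.simps(2))
  moreover have "?c / 2 * (x * density s (Suc n) (1/2)
        + (\<Sum>j\<le>n. (left_inv ^^ Suc j) x * density s (n - j) (1/2)))
      \<le> exp s * (mass s (Suc n) ?b - mass s (Suc n) (1/2)) + mass s (Suc n) (left_inv x)"
    unfolding distrib_left by (intro add_mono left right)
  ultimately show ?case by simp
qed

lemma density_at_0: "density s (Suc n) 0 = 1 + exp s / 2 * (\<Sum>k\<le>n. density s k (1/2))"
proof (induction n)
  case 0
  then show ?case by (simp add: left_slope_def)
next
  case (Suc n)
  have "density s (Suc (Suc n)) 0 = density s (Suc n) 0 + exp s / 2 * density s (Suc n) (1/2)"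
    by (simp add: left_slope_def del: density.simps(2) add: density.simps(2)[of s "Suc n"])
  with Suc show ?case by (simp add: algebra_simps del: density.simps)
qed

end

section \<open>Differentiability along continuous functions\<close>

context manneville_pomeau
begin

abbreviation geom :: "real \<Rightarrow> real" where "geom \<equiv> geometric_potential \<alpha>"

text \<open>
  Only the right branch is reweighted, and by a constant. This is what keeps the monotonicity
  properties of the densities; a bias supported on \<open>[\<delta>,1]\<close> for small \<open>\<delta>\<close> could destroy them.
\<close>

definition right_biased :: "real \<Rightarrow> real \<Rightarrow> real" where
  "right_biased s y = geom y + s * indicator {1/2..1} y"

lemma mp_map_eq: "mp_map \<alpha> y = (if y < 1/2 then left_map y else 2 * y - 1)"
  by (simp add: mp_map_def left_map_def q_def)

lemma mp_map_left_inv: "0 \<le> x \<Longrightarrow> x < 1 \<Longrightarrow> mp_map \<alpha> (left_inv x) = x"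
  using left_inv_less_half[of x] left_map_left_inv[of x] by (simp add: mp_map_eq)

lemma fibre_less_1:
  assumes "0 \<le> x" "x < 1"
  shows "{y. y \<in> {0..1} \<and> mp_map \<alpha> y = x} = {left_inv x, (x + 1) / 2}"
proof (intro equalityI subsetI)
  fix y assume "y \<in> {y. y \<in> {0..1} \<and> mp_map \<alpha> y = x}"
  then show "y \<in> {left_inv x, (x + 1) / 2}"
    using left_inv_unique[of y] by (cases "y < 1/2") (auto simp: mp_map_eq)
next
  fix y assume "y \<in> {left_inv x, (x + 1) / 2}"
  then show "y \<in> {y. y \<in> {0..1} \<and> mp_map \<alpha> y = x}"
    using assms left_inv[of x] mp_map_left_inv[OF assms] by (auto simp: mp_map_eq)
qed

lemma fibre_1: "{y. y \<in> {0..1} \<and> mp_map \<alpha> y = 1} = {1}"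
proof -
  have "left_map y \<noteq> 1" if "0 \<le> y" "y < 1/2" for y
    using left_map_strict_mono[OF that] by simp
  then show ?thesis by (auto simp: mp_map_eq split: if_splits)
qed

lemma finite_fibre_mp: "finite_fibre_map (mp_map \<alpha>) 2"
proof
  fix x :: real
  assume "x \<in> {0..1}"
  then consider "0 \<le> x" "x < 1" | "x = 1" by fastforce
  note cases = this
  show "finite {y. y \<in> {0..1} \<and> mp_map \<alpha> y = x}"
    by (cases rule: cases) (use fibre_less_1[of x] fibre_1 in auto)
  show "{y. y \<in> {0..1} \<and> mp_map \<alpha> y = x} \<noteq> {}"
    by (cases rule: cases) (use fibre_less_1[of x] fibre_1 in auto)
  show "card {y. y \<in> {0..1} \<and> mp_map \<alpha> y = x} \<le> 2"
    by (cases rule: cases) (use fibre_less_1[of x] fibre_1 card_insert_le_m1 in \<open>auto simp: card_insert_if\<close>)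
qed

lemma geom_left: "0 \<le> y \<Longrightarrow> y < 1/2 \<Longrightarrow> geom y = - ln (left_slope y)"
  and geom_right: "1/2 \<le> y \<Longrightarrow> y \<le> 1 \<Longrightarrow> geom y = - ln 2"
  using geometric_potential_eq[OF \<alpha>, of y] by (simp_all add: left_slope_def q_def)

lemma geom_0 [simp]: "geom 0 = 0"
  by (simp add: geom_left left_slope_def)

lemma bounded_geom: "bounded (geom ` {0..1})"
  unfolding bounded_iff
proof (intro exI ballI)
  fix z assume "z \<in> geom ` {0..1}"
  then obtain y where y: "y \<in> {0..1}" and z: "z = geom y" by blast
  show "norm z \<le> ln (2 + \<alpha>)"
  proof (cases "y < 1/2")
    case True
    have "left_slope y \<le> left_slope (1/2)" using True y by (intro left_slope_mono) auto
    then have "left_slope y \<le> 2 + \<alpha>" unfolding left_slope_def[of "1/2"] q_half by simp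
    then have "ln (left_slope y) \<le> ln (2 + \<alpha>)"
      using left_slope_ge_1[of y] by (intro ln_mono) auto
    then show ?thesis using True y z geom_left[of y] left_slope_ge_1[of y] by simp
  next
    case False
    then show ?thesis using y z geom_right[of y] \<alpha> by simp
  qed
qed

lemma bounded_potential_geom: "bounded_potential (mp_map \<alpha>) 2 geom"
  unfolding bounded_potential_def bounded_potential_axioms_def
  using finite_fibre_mp bounded_geom by blast

lemma bounded_potential_perturbed:
  assumes "bounded (\<psi> ` {0..1})"
  shows "bounded_potential (mp_map \<alpha>) 2 (\<lambda>x. geom x + \<psi> x)"
  unfolding bounded_potential_def bounded_potential_axioms_def
  using finite_fibre_mp bounded_plus_comp[OF bounded_geom assms] by blast

lemma bounded_potential_right_biased: "bounded_potential (mp_map \<alpha>) 2 (right_biased s)"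
proof -
  have "bounded ((\<lambda>y. s * indicator {1/2..1} y) ` {0..1::real})"
    unfolding bounded_iff by (intro exI[of _ "\<bar>s\<bar>"]) (auto simp: indicator_def)
  from bounded_potential_perturbed[OF this] show ?thesis
    unfolding right_biased_def[abs_def] .
qed

lemma transfer_right_biased:
  assumes "0 \<le> x" "x < 1"
  shows "transfer_operator (mp_map \<alpha>) (right_biased s) g x
    = g (left_inv x) / left_slope (left_inv x) + exp s / 2 * g ((x + 1) / 2)"
proof -
  have a: "0 \<le> left_inv x" "left_inv x < 1/2"
    using left_inv_ge_0[of x] left_inv_less_half[of x] assms by auto
  have "exp (right_biased s (left_inv x)) = 1 / left_slope (left_inv x)"
    using a left_slope_ge_1[of "left_inv x"]
    by (simp add: right_biased_def geom_left exp_minus inverse_eq_divide)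
  moreover have "exp (right_biased s ((x + 1) / 2)) = exp s / 2"
    using assms geom_right[of "(x + 1) / 2"]
    by (simp add: right_biased_def exp_diff)
  moreover have "left_inv x \<noteq> (x + 1) / 2" using a assms by simp
  ultimately show ?thesis
    unfolding transfer_operator_def fibre_less_1[OF assms] by simp
qed

lemma transfer_right_biased_1:
  "transfer_operator (mp_map \<alpha>) (right_biased s) g 1 = exp s / 2 * g 1"
  unfolding transfer_operator_def fibre_1
  by (simp add: right_biased_def geom_right exp_diff)

lemma iterate_eq_density:
  assumes "0 \<le> x" "x < 1"
  shows "(transfer_operator (mp_map \<alpha>) (right_biased s) ^^ n) (\<lambda>_. 1) x = density s n x"
  using assms
proof (induction n arbitrary: x)
  case (Suc n)
  have "0 \<le> left_inv x" "left_inv x < 1"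
    using left_inv_ge_0[of x] left_inv_less_half[of x] Suc.prems by auto
  then show ?case using Suc by (simp add: transfer_right_biased)
qed simp

lemma iterate_le_density:
  assumes "x \<in> {0..1}"
  shows "(transfer_operator (mp_map \<alpha>) (right_biased s) ^^ n) (\<lambda>_. 1) x \<le> density s n x"
proof (cases "x < 1")
  case True
  then show ?thesis using assms iterate_eq_density[of x n s] by simp
next
  case False
  have "(transfer_operator (mp_map \<alpha>) (right_biased s) ^^ n) (\<lambda>_. 1) 1 \<le> density s n 1"
  proof (induction n)
    case (Suc n)
    have "0 \<le> density s n (left_inv 1) / left_slope (left_inv 1)"
      using density_nonneg[of s n "left_inv 1"] left_slope_ge_1[of "left_inv 1"] by simp
    moreover have "exp s / 2 * (transfer_operator (mp_map \<alpha>) (right_biased s) ^^ n) (\<lambda>_. 1) 1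
        \<le> exp s / 2 * density s n 1"
      using Suc by (intro mult_left_mono) auto
    moreover have "(transfer_operator (mp_map \<alpha>) (right_biased s) ^^ Suc n) (\<lambda>_. 1) 1
        = exp s / 2 * (transfer_operator (mp_map \<alpha>) (right_biased s) ^^ n) (\<lambda>_. 1) 1"
      by (simp add: transfer_right_biased_1)
    moreover have "density s (Suc n) 1 = density s n (left_inv 1) / left_slope (left_inv 1) + exp s / 2 * density s n 1"
      by simp
    ultimately show ?case by linarith
  qed simp
  with False assms show ?thesis by simp
qed

lemma pressure_right_biased_bound:
  fixes s :: real and m :: nat
  defines "\<rho> \<equiv> exp (pressure (mp_map \<alpha>) (right_biased s))"
  assumes s: "0 \<le> s" and \<rho>: "1 < \<rho>"
  shows "(1/2) powr (1 + \<alpha>) / 2 * (\<Sum>j<m. preimage_1 j) * (1 - 1 / \<rho>) \<le> (exp s - 1) / 2 * \<rho> ^ m"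
proof (rule renewal_growth_bound[where v = "\<lambda>k. density s k (1/2)" and \<tau> = "exp s / 2"])
  interpret bounded_potential "mp_map \<alpha>" 2 "right_biased s" by (rule bounded_potential_right_biased)
  show "0 \<le> density s k (1/2)" for k by (rule density_nonneg)
  show "0 \<le> preimage_1 j" "preimage_1 j \<le> 1" for j using iterate_left_inv_mem[of 1 j] by auto
  show "(1/2) powr (1 + \<alpha>) / 2 * (\<Sum>j\<le>n. preimage_1 j * density s (n - j) (1/2))
      \<le> 1 + (exp s - 1) / 2 * (\<Sum>k\<le>n. density s k (1/2))" for n
    using mass_ge_convolution[OF s, of 1 n] mass_total_le[OF s, of n] by (simp del: mass.simps)
  show "\<rho> ^ Suc n \<le> 1 + exp s / 2 * (\<Sum>k\<le>n. density s k (1/2))" for n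
  proof -
    have "growth (right_biased s) (Suc n) \<le> density s (Suc n) 0"
    proof (rule growth_leI)
      fix x :: real assume "x \<in> {0..1}"
      then show "iterate_one (right_biased s) (Suc n) x \<le> density s (Suc n) 0"
        using iterate_le_density[of x "Suc n" s] density_antimono[of 0 x s "Suc n"]
        by (simp del: density.simps funpow.simps)
    qed
    then show ?thesis
      using exp_pressure_power_le_growth[of "Suc n"] unfolding \<rho>_def density_at_0 by linarith
  qed
  show "summable (\<lambda>k. z ^ k * density s k (1/2))" if z: "0 < z" "z < 1 / \<rho>" for z
  proof -
    have "\<rho> < 1 / z" using z \<rho> by (simp add: field_simps)
    then obtain \<mu> where \<mu>: "\<rho> < \<mu>" "\<mu> < 1 / z" using dense by blast
    have "0 < \<mu>" using \<mu> \<rho> by simp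
    have "pressure (mp_map \<alpha>) (right_biased s) < ln \<mu>"
      using \<mu>(1) \<open>0 < \<mu>\<close> unfolding \<rho>_def by (metis exp_less_cancel_iff exp_ln)
    then have "\<forall>\<^sub>F n in sequentially. ln (growth (right_biased s) n) / real n < ln \<mu>"
      by (rule order_tendstoD(2)[OF pressure_limit])
    then have ev: "\<forall>\<^sub>F n in sequentially. norm (z ^ n * density s n (1/2)) \<le> (z * \<mu>) ^ n"
      using eventually_gt_at_top[of "0::nat"]
    proof eventually_elim
      case (elim n)
      then have "ln (growth (right_biased s) n) \<le> real n * ln \<mu>" by (simp add: field_simps)
      then have "exp (ln (growth (right_biased s) n)) \<le> exp (real n * ln \<mu>)" by simp
      then have "growth (right_biased s) n \<le> \<mu> ^ n"
        using growth_pos[of n] \<open>0 < \<mu>\<close> by (simp add: exp_of_nat_mult)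
      then have "density s n (1/2) \<le> \<mu> ^ n"
        using iterate_one_le_growth[of "1/2" n] iterate_eq_density[of "1/2" n s] by simp
      then show ?case
        using z density_nonneg[of s n "1/2"] by (simp add: power_mult_distrib)
    qed
    have "summable (\<lambda>n. (z * \<mu>) ^ n)"
      using z \<mu> \<open>0 < \<mu>\<close> by (intro summable_geometric) (simp add: field_simps)
    then show ?thesis using ev by (rule summable_comparison_test_ev[rotated])
  qed
qed (use s \<rho> in simp_all)

lemma pressure_ge_at_0:
  assumes "bounded (\<psi> ` {0..1})"
  shows "\<psi> 0 \<le> pressure (mp_map \<alpha>) (\<lambda>x. geom x + \<psi> x)"
proof -
  interpret bounded_potential "mp_map \<alpha>" 2 "\<lambda>x. geom x + \<psi> x"
    by (rule bounded_potential_perturbed) fact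
  show ?thesis
  proof (rule pressure_ge_orbit[where y = "\<lambda>_. 0" and G = sequentially and h = "\<lambda>_. \<psi> 0"])
    show "\<forall>\<^sub>F n in sequentially. \<psi> 0 \<le> (\<Sum>k=1..n. geom 0 + \<psi> 0) / real n"
      using eventually_gt_at_top[of "0::nat"] by eventually_elim simp
  qed (simp_all add: mp_map_eq)
qed

text \<open>
  The lower bound comes from the neutral fixed point, whose multiplier is \<open>1\<close>. For the upper bound:
  without bias the total mass is conserved, so the renewal bound with \<open>m = 1\<close> excludes exponential
  growth.
\<close>

lemma pressure_geom: "pressure (mp_map \<alpha>) geom = 0"
proof -
  have "0 \<le> pressure (mp_map \<alpha>) geom"
    using pressure_ge_at_0[of "\<lambda>_. 0"] by (simp add: image_constant_conv)
  moreover have "pressure (mp_map \<alpha>) geom \<le> 0"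
  proof (rule ccontr)
    have eq: "right_biased 0 = geom" by (simp add: right_biased_def fun_eq_iff)
    assume "\<not> pressure (mp_map \<alpha>) geom \<le> 0"
    then have pos: "1 < exp (pressure (mp_map \<alpha>) geom)" by simp
    then have "(1/2) powr (1 + \<alpha>) / 2 * (1 - 1 / exp (pressure (mp_map \<alpha>) geom)) \<le> 0"
      using pressure_right_biased_bound[of 0 1] by (simp add: eq)
    moreover have "0 < (1/2) powr (1 + \<alpha>) / 2 * (1 - 1 / exp (pressure (mp_map \<alpha>) geom))"
      using pos by (intro mult_pos_pos) auto
    ultimately show False by linarith
  qed
  ultimately show ?thesis by simp
qed

lemma pressure_right_biased_le:
  assumes "0 \<le> s"
  shows "pressure (mp_map \<alpha>) (right_biased s) \<le> s"
proof -
  have "pressure (mp_map \<alpha>) (right_biased s) \<le> pressure (mp_map \<alpha>) geom + s"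
    by (rule pressure_compare[OF bounded_potential_right_biased bounded_potential_geom,
          where w = "\<lambda>_. 0" and W = 0])
      (use assms in \<open>auto simp: right_biased_def indicator_def\<close>)
  then show ?thesis by (simp add: pressure_geom)
qed

text \<open>
  The renewal bound gives \<open>W * P \<le> const * s\<close>, with \<open>W\<close> the sum of the first \<open>m\<close> preimages of \<open>1\<close>.
  Since \<open>W\<close> is unbounded in \<open>m\<close>, the right derivative of the pressure at \<open>s = 0\<close> vanishes.
\<close>

lemma pressure_right_biased_small:
  assumes \<epsilon>: "0 < \<epsilon>"
  obtains \<delta> where "0 < \<delta>"
    and "\<And>s. 0 \<le> s \<Longrightarrow> s \<le> \<delta> \<Longrightarrow> pressure (mp_map \<alpha>) (right_biased s) \<le> \<epsilon> * s"
proof -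
  define c where "c = (1/2) powr (1 + \<alpha>) / 2"
  have c: "0 < c" by (simp add: c_def)
  obtain m where m: "1 / (c * \<epsilon>) \<le> (\<Sum>j<m. preimage_1 j)" using sum_preimage_1_unbounded by blast
  define W where "W = (\<Sum>j<m. preimage_1 j)"
  have W: "1 \<le> \<epsilon> * (c * W)" using m c \<epsilon> by (simp add: W_def field_simps)
  \<comment> \<open>The powers \<open>\<rho> ^ m\<close> and the other exponential corrections then cost at most a factor \<open>2\<close>.\<close>
  define \<delta> where "\<delta> = ln 2 / (real m + 2)"
  have "pressure (mp_map \<alpha>) (right_biased s) \<le> \<epsilon> * s" if s: "0 \<le> s" "s \<le> \<delta>" for s
  proof (cases "0 < pressure (mp_map \<alpha>) (right_biased s)")
    case False
    moreover have "0 \<le> \<epsilon> * s" using \<epsilon> s by simp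
    ultimately show ?thesis by linarith
  next
    case True
    define P where "P = pressure (mp_map \<alpha>) (right_biased s)"
    have P: "0 < P" "P \<le> s" using True pressure_right_biased_le[OF s(1)] by (auto simp: P_def)
    have "1 \<le> exp (P + real m * P)" using P by simp
    have "c * W * P \<le> c * W * ((1 - 1 / exp P) * exp P)"
    proof (intro mult_left_mono mult_nonneg_nonneg)
      show "P \<le> (1 - 1 / exp P) * exp P" using exp_ge_add_one_self[of P] by (simp add: algebra_simps)
      show "0 \<le> W" unfolding W_def using preimage_1_pos by (intro sum_nonneg) (auto intro: less_imp_le)
    qed (use c in simp)
    also have "\<dots> = c * W * (1 - 1 / exp P) * exp P" by simp
    also have "\<dots> \<le> (exp s - 1) / 2 * exp P ^ m * exp P"
      using pressure_right_biased_bound[of s m] s P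
      by (intro mult_right_mono) (auto simp: P_def c_def W_def)
    also have "\<dots> = (exp s - 1) / 2 * exp ((real m + 1) * P)"
      by (simp add: algebra_simps exp_add flip: exp_of_nat_mult)
    also have "\<dots> \<le> (s * exp s) / 2 * exp ((real m + 1) * s)"
    proof (intro mult_mono)
      have "1 - s \<le> exp (- s)" using exp_ge_add_one_self[of "- s"] by simp
      then have "(1 - s) * exp s \<le> exp (- s) * exp s" by (intro mult_right_mono) auto
      then have "exp s - 1 \<le> s * exp s" by (simp add: algebra_simps flip: exp_add)
      then show "(exp s - 1) / 2 \<le> s * exp s / 2" by simp
    qed (use P s in \<open>auto intro!: mult_left_mono\<close>)
    also have "\<dots> = s / 2 * exp ((real m + 2) * s)" by (simp add: algebra_simps flip: exp_add)
    also have "\<dots> \<le> s / 2 * 2"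
    proof (intro mult_left_mono)
      have "(real m + 2) * s \<le> ln 2" using s by (simp add: \<delta>_def field_simps)
      then have "exp ((real m + 2) * s) \<le> exp (ln 2)" by (simp only: exp_le_cancel_iff)
      then show "exp ((real m + 2) * s) \<le> 2" by simp
    qed (use s in simp)
    finally have "\<epsilon> * (c * W * P) \<le> \<epsilon> * s" using \<epsilon> by simp
    moreover have "1 * P \<le> \<epsilon> * (c * W) * P" using W P by (intro mult_right_mono) auto
    ultimately show ?thesis by (simp add: P_def algebra_simps)
  qed
  moreover have "0 < \<delta>" by (simp add: \<delta>_def)
  ultimately show thesis using that by blast
qed

text \<open>
  A continuous \<open>\<psi>\<close> exceeds \<open>\<psi> 0\<close> by more than \<open>\<epsilon>/2\<close> only away from \<open>0\<close>. There the left branch moves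
  points to the right by a definite amount, so a multiple of the coboundary \<open>f y - y\<close> absorbs the
  excess on the left half and leaves a multiple of the indicator of the right half.
\<close>

lemma pressure_right_derivative:
  assumes cont: "continuous_on {0..1} \<psi>" and \<epsilon>: "0 < \<epsilon>"
  obtains \<delta> where "0 < \<delta>" and "\<And>t. 0 \<le> t \<Longrightarrow> t < \<delta> \<Longrightarrow>
    pressure (mp_map \<alpha>) (\<lambda>x. geom x + t * \<psi> x) \<le> t * (\<psi> 0 + \<epsilon>)"
proof -
  have bounded: "bounded (\<psi> ` {0..1})"
    by (intro compact_imp_bounded compact_continuous_image cont) simp
  then obtain B where "\<forall>z\<in>\<psi> ` {0..1}. norm z \<le> B" unfolding bounded_iff by blast
  then have B: "\<bar>\<psi> y\<bar> \<le> B" if "y \<in> {0..1}" for y using that by simp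
  obtain d where d: "0 < d" "\<And>y. y \<in> {0..1} \<Longrightarrow> dist y 0 < d \<Longrightarrow> dist (\<psi> y) (\<psi> 0) < \<epsilon> / 2"
    using cont \<epsilon> unfolding continuous_on_iff by (metis atLeastAtMost_iff half_gt_zero order_refl zero_le_one)
  define K where "K = 2 * B"
  have K: "\<psi> y \<le> \<psi> 0 + K" "0 \<le> K" if "y \<in> {0..1}" for y
    using B[OF that] B[of 0] by (auto simp: K_def abs_le_iff)
  define M where "M = K / (d * q d)"
  have qd: "0 < q d" using d(1) by (simp add: q_def)
  have M: "0 \<le> M" using K(2)[of 0] d(1) qd by (simp add: M_def)
  have le: "\<psi> y \<le> \<psi> 0 + \<epsilon> / 2 + (K + M) * indicator {1/2..1} y + M * (mp_map \<alpha> y - y)"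
    if y: "y \<in> {0..1}" for y
  proof (cases "y < 1/2")
    case True
    have drift: "mp_map \<alpha> y - y = y * q y" using True by (simp add: mp_map_eq left_map_def algebra_simps)
    show ?thesis
    proof (cases "y < d")
      case True
      have "dist (\<psi> y) (\<psi> 0) < \<epsilon> / 2" using True y by (intro d(2)) (auto simp: dist_real_def)
      then have "\<psi> y \<le> \<psi> 0 + \<epsilon> / 2" unfolding dist_real_def by linarith
      moreover have "0 \<le> M * (mp_map \<alpha> y - y)" unfolding drift using M y by simp
      ultimately show ?thesis using \<open>y < 1/2\<close> by simp
    next
      case False
      have "M * (d * q d) \<le> M * (y * q y)"
        using False d(1) M y by (intro mult_left_mono mult_mono q_mono) auto
      then have "K \<le> M * (y * q y)" using d(1) qd by (simp add: M_def)
      then show ?thesis using K(1)[OF y] \<epsilon> \<open>y < 1/2\<close> by (simp add: drift)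
    qed
  next
    case False
    have "M * (1 - y) \<le> M * 1" using M y by (intro mult_left_mono) auto
    then show ?thesis using K(1)[OF y] \<epsilon> False y by (simp add: mp_map_eq algebra_simps)
  qed
  define C where "C = K + M"
  have C: "0 \<le> C" using K(2)[of 0] M by (simp add: C_def)
  have "0 < \<epsilon> / (2 * (C + 1))" using \<epsilon> C by simp
  then obtain \<delta> where \<delta>: "0 < \<delta>" "\<And>s. 0 \<le> s \<Longrightarrow> s \<le> \<delta> \<Longrightarrow>
      pressure (mp_map \<alpha>) (right_biased s) \<le> \<epsilon> / (2 * (C + 1)) * s"
    using pressure_right_biased_small by blast
  have "pressure (mp_map \<alpha>) (\<lambda>x. geom x + t * \<psi> x) \<le> t * (\<psi> 0 + \<epsilon>)" if t: "0 \<le> t" "t < \<delta> / (C + 1)" for t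
  proof -
    have bt: "bounded ((\<lambda>x. t * \<psi> x) ` {0..1})"
      by (intro compact_imp_bounded compact_continuous_image continuous_intros cont) simp
    have "pressure (mp_map \<alpha>) (\<lambda>x. geom x + t * \<psi> x)
        \<le> pressure (mp_map \<alpha>) (right_biased (t * C)) + t * (\<psi> 0 + \<epsilon> / 2)"
    proof (rule pressure_compare[OF bounded_potential_perturbed[OF bt] bounded_potential_right_biased,
          where w = "\<lambda>y. t * M * y" and W = "t * M"])
      fix y :: real assume y: "y \<in> {0..1}"
      have "t * \<psi> y \<le> t * (\<psi> 0 + \<epsilon> / 2 + (K + M) * indicator {1/2..1} y + M * (mp_map \<alpha> y - y))"
        using le[OF y] t by (intro mult_left_mono)
      then show "geom y + t * \<psi> y \<le> right_biased (t * C) y + t * (\<psi> 0 + \<epsilon> / 2)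
          + t * M * mp_map \<alpha> y - t * M * y"
        by (simp add: right_biased_def C_def algebra_simps)
      show "\<bar>t * M * y\<bar> \<le> t * M"
        using y M t by (simp add: abs_mult mult_left_le)
    qed
    also have "pressure (mp_map \<alpha>) (right_biased (t * C)) \<le> \<epsilon> / (2 * (C + 1)) * (t * C)"
    proof (rule \<delta>(2))
      have "t * C \<le> t * (C + 1)" using t by (intro mult_left_mono) auto
      also have "\<dots> \<le> \<delta>" using t(2) C by (simp add: field_simps)
      finally show "t * C \<le> \<delta>" .
    qed (use t C in simp)
    also have "\<epsilon> / (2 * (C + 1)) * (t * C) \<le> t * (\<epsilon> / 2)"
    proof -
      have "\<epsilon> / (2 * (C + 1)) * (t * C) = t * (\<epsilon> / 2) * (C / (C + 1))" by simp
      also have "\<dots> \<le> t * (\<epsilon> / 2) * 1" using t \<epsilon> C by (intro mult_left_mono) auto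
      finally show ?thesis by simp
    qed
    finally show ?thesis by (simp add: algebra_simps)
  qed
  moreover have "0 < \<delta> / (C + 1)" using \<delta>(1) C by simp
  ultimately show thesis using that by blast
qed

lemma pressure_continuous_derivative:
  assumes cont: "continuous_on {0..1} \<psi>"
  shows "((\<lambda>t. (pressure (mp_map \<alpha>) (\<lambda>x. geom x + t * \<psi> x) - pressure (mp_map \<alpha>) geom) / t)
    \<longlongrightarrow> \<psi> 0) (at 0)"
proof (rule LIM_I)
  fix \<epsilon> :: real assume "0 < \<epsilon>"
  then have half: "0 < \<epsilon> / 2" by simp
  let ?P = "\<lambda>t. pressure (mp_map \<alpha>) (\<lambda>x. geom x + t * \<psi> x)"
  have cont': "continuous_on {0..1} (\<lambda>x. - \<psi> x)" by (intro continuous_intros cont)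
  obtain \<delta>1 where \<delta>1: "0 < \<delta>1" "\<And>t. 0 \<le> t \<Longrightarrow> t < \<delta>1 \<Longrightarrow> ?P t \<le> t * (\<psi> 0 + \<epsilon> / 2)"
    using pressure_right_derivative[OF cont half] by blast
  obtain \<delta>2 where \<delta>2: "0 < \<delta>2" "\<And>t. 0 \<le> t \<Longrightarrow> t < \<delta>2 \<Longrightarrow>
      pressure (mp_map \<alpha>) (\<lambda>x. geom x + t * - \<psi> x) \<le> t * (- \<psi> 0 + \<epsilon> / 2)"
    using pressure_right_derivative[OF cont' half] by blast
  have lower: "t * \<psi> 0 \<le> ?P t" for t
    by (rule pressure_ge_at_0[of "\<lambda>x. t * \<psi> x"])
      (intro compact_imp_bounded compact_continuous_image continuous_intros cont compact_Icc)
  show "\<exists>s>0. \<forall>t. t \<noteq> 0 \<and> norm (t - 0) < s \<longrightarrow>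
      norm ((?P t - pressure (mp_map \<alpha>) geom) / t - \<psi> 0) < \<epsilon>"
  proof (intro exI[of _ "min \<delta>1 \<delta>2"] conjI allI impI)
    fix t :: real assume t: "t \<noteq> 0 \<and> norm (t - 0) < min \<delta>1 \<delta>2"
    have "\<bar>?P t - t * \<psi> 0\<bar> \<le> \<bar>t\<bar> * (\<epsilon> / 2)"
    proof (cases "0 < t")
      case True
      then show ?thesis using \<delta>1(2)[of t] lower[of t] t by (simp add: algebra_simps)
    next
      case False
      then show ?thesis using \<delta>2(2)[of "- t"] lower[of t] t by (simp add: algebra_simps)
    qed
    then have "\<bar>(?P t - t * \<psi> 0) / t\<bar> \<le> \<epsilon> / 2" using t by (simp add: abs_divide field_simps)
    moreover have "(?P t - t * \<psi> 0) / t = ?P t / t - \<psi> 0" using t by (simp add: field_simps)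
    ultimately show "norm ((?P t - pressure (mp_map \<alpha>) geom) / t - \<psi> 0) < \<epsilon>"
      using \<open>0 < \<epsilon>\<close> by (simp add: pressure_geom)
  qed (use \<delta>1 \<delta>2 in simp)
qed

section \<open>A backward orbit converging to the neutral fixed point\<close>

text \<open>
  The orbit starts at \<open>1/2\<close> and not at \<open>1\<close>, because the map sends \<open>1/2\<close> to \<open>0\<close>.
\<close>

definition left_orbit :: "nat \<Rightarrow> real" where "left_orbit k = preimage_1 (Suc k)"

lemma left_orbit_mem: "left_orbit k \<in> {0..1}" and left_orbit_pos: "0 < left_orbit k"
  using iterate_left_inv_mem[of 1 "Suc k"] preimage_1_pos[of "Suc k"] by (auto simp: left_orbit_def)

lemma left_orbit_le_half: "left_orbit k \<le> 1/2"
  using left_inv_le_half[of "preimage_1 k"] iterate_left_inv_mem[of 1 k] by (simp add: left_orbit_def)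

lemma mp_map_left_orbit: "mp_map \<alpha> (left_orbit (Suc k)) = left_orbit k"
  using mp_map_left_inv[of "left_orbit k"] left_orbit_pos[of k] left_orbit_le_half[of k]
  by (simp add: left_orbit_def)

text \<open>
  By Bernoulli's inequality each slope is at most the \<open>(1 + \<alpha>)\<close>-th power of the ratio of consecutive
  orbit points. The product telescopes, and the orbit approaches \<open>0\<close> only polynomially.
\<close>

lemma geom_left_orbit_sum: "- (1 + \<alpha>) * ln (3 + 2 * real n) \<le> (\<Sum>k=1..n. geom (left_orbit k))"
proof -
  have step: "(1 + \<alpha>) * (ln (left_orbit (Suc k)) - ln (left_orbit k)) \<le> geom (left_orbit (Suc k))" for k
  proof -
    let ?y = "left_orbit (Suc k)"
    have less: "?y < 1/2"
      using left_inv_less_half[of "left_orbit k"] left_orbit_pos[of k] left_orbit_le_half[of k]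
      by (simp add: left_orbit_def)
    have "left_orbit k = ?y * (1 + q ?y)"
      using mp_map_left_orbit[of k] less by (simp add: mp_map_eq left_map_def)
    moreover have "0 < 1 + q ?y" by (intro add_pos_nonneg) auto
    ultimately have "ln (left_orbit k) = ln ?y + ln (1 + q ?y)"
      using left_orbit_pos[of "Suc k"] by (simp add: ln_mult)
    moreover have "left_slope ?y \<le> (1 + q ?y) powr (1 + \<alpha>)"
      using one_plus_mult_le_powr[of "1 + \<alpha>" "q ?y"] \<alpha> by (simp add: left_slope_def)
    then have "ln (left_slope ?y) \<le> ln ((1 + q ?y) powr (1 + \<alpha>))"
      using left_slope_ge_1[of ?y] by (intro ln_mono) auto
    then have "ln (left_slope ?y) \<le> (1 + \<alpha>) * ln (1 + q ?y)" by (simp add: ln_powr)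
    ultimately show ?thesis
      using less left_orbit_pos[of "Suc k"] geom_left[of ?y] by (simp add: algebra_simps)
  qed
  have "(1 + \<alpha>) * (ln (left_orbit n) - ln (left_orbit 0)) \<le> (\<Sum>k=1..n. geom (left_orbit k))"
  proof (induction n)
    case (Suc n)
    have "(1 + \<alpha>) * (ln (left_orbit (Suc n)) - ln (left_orbit 0))
        = (1 + \<alpha>) * (ln (left_orbit n) - ln (left_orbit 0))
          + (1 + \<alpha>) * (ln (left_orbit (Suc n)) - ln (left_orbit n))" by (simp add: algebra_simps)
    also have "\<dots> \<le> (\<Sum>k=1..n. geom (left_orbit k)) + geom (left_orbit (Suc n))"
      by (intro add_mono Suc step)
    finally show ?case by simp
  qed simp
  moreover have "(1 + \<alpha>) * - ln (3 + 2 * real n) \<le> (1 + \<alpha>) * (ln (left_orbit n) - ln (left_orbit 0))"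
  proof (intro mult_left_mono)
    have "1 / (3 + 2 * real n) \<le> left_orbit n"
      using preimage_1_ge[of "Suc n"] by (simp add: left_orbit_def add.commute)
    then have "ln (1 / (3 + 2 * real n)) \<le> ln (left_orbit n)" by (intro ln_mono) auto
    then have "- ln (3 + 2 * real n) \<le> ln (left_orbit n)" by (simp add: ln_div)
    moreover have "ln (left_orbit 0) \<le> 0"
      using left_orbit_pos[of 0] left_orbit_mem[of 0] by simp
    ultimately show "- ln (3 + 2 * real n) \<le> ln (left_orbit n) - ln (left_orbit 0)" by linarith
  qed (use \<alpha> in simp)
  ultimately show ?thesis by linarith
qed

lemma left_orbit_average:
  "(\<lambda>n. - (1 + \<alpha>) * (ln 5 / real n + ln (real n) / real n)) \<longlonglongrightarrow> 0"
  "- (1 + \<alpha>) * (ln 5 / real n + ln (real n) / real n) \<le> (\<Sum>k=1..n. geom (left_orbit k)) / real n"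
proof -
  have "(\<lambda>n. - (1 + \<alpha>) * (ln 5 / real n + ln (real n) / real n)) \<longlonglongrightarrow> - (1 + \<alpha>) * (0 + 0)"
    by (intro tendsto_intros lim_const_over_n lim_ln_over_n)
  then show "(\<lambda>n. - (1 + \<alpha>) * (ln 5 / real n + ln (real n) / real n)) \<longlonglongrightarrow> 0" by simp
  show "- (1 + \<alpha>) * (ln 5 / real n + ln (real n) / real n) \<le> (\<Sum>k=1..n. geom (left_orbit k)) / real n"
  proof (cases "n = 0")
    case False
    then have "ln (3 + 2 * real n) \<le> ln (5 * real n)" by (intro ln_mono) auto
    also have "\<dots> = ln 5 + ln (real n)" using False by (simp add: ln_mult)
    finally have "(1 + \<alpha>) * ln (3 + 2 * real n) \<le> (1 + \<alpha>) * (ln 5 + ln (real n))"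
      using \<alpha> by (intro mult_left_mono) auto
    then have "- (1 + \<alpha>) * (ln 5 + ln (real n)) \<le> (\<Sum>k=1..n. geom (left_orbit k))"
      using geom_left_orbit_sum[of n] by linarith
    then have "- (1 + \<alpha>) * (ln 5 + ln (real n)) / real n \<le> (\<Sum>k=1..n. geom (left_orbit k)) / real n"
      by (intro divide_right_mono) auto
    then show ?thesis by (simp only: times_divide_eq_right add_divide_distrib[symmetric])
  qed simp
qed

text \<open>
  The empirical measures of the constant orbit at \<open>0\<close> give the point mass at \<open>0\<close>. A cluster point of those of
  \<^const>\<open>left_orbit\<close> is concentrated on points arbitrarily close to \<open>0\<close> but gives \<open>{0}\<close> itself no mass.
\<close>

lemma two_tangent_functionals:
  "\<exists>S \<subseteq> tangent_functionals (mp_map \<alpha>) geom. card S = 2"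
proof -
  interpret bounded_potential "mp_map \<alpha>" 2 geom by (rule bounded_potential_geom)
  let ?r = "\<lambda>\<mu>. restrict \<mu> (sets unit_borel)"
  have dirac: "?r (\<lambda>A. indicator A (0::real)) \<in> tangent_functionals (mp_map \<alpha>) geom"
  proof (rule tangent_functional_of_orbit[where y = "\<lambda>_. 0" and G = sequentially and h = "\<lambda>_. 0"])
    show "(\<lambda>n. empirical_measure (\<lambda>_. 0) n A) \<longlonglongrightarrow> indicator A 0" for A
    proof (rule tendsto_eventually)
      show "\<forall>\<^sub>F n in sequentially. empirical_measure (\<lambda>_. 0) n A = indicator A 0"
        using eventually_gt_at_top[of "0::nat"] by eventually_elim (simp add: empirical_measure_def)
    qed
  qed (simp_all add: mp_map_eq pressure_geom)
  obtain G \<mu> where G: "G \<noteq> bot" "G \<le> sequentially"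
    and \<mu>: "\<And>A. ((\<lambda>n. empirical_measure left_orbit n A) \<longlongrightarrow> \<mu> A) G"
    using pointwise_cluster_point[of "empirical_measure left_orbit"] empirical_measure_range by blast
  have cluster: "?r \<mu> \<in> tangent_functionals (mp_map \<alpha>) geom"
    using left_orbit_mem mp_map_left_orbit G \<mu> _ left_orbit_average(2)
  proof (rule tangent_functional_of_orbit)
    show "((\<lambda>n. - (1 + \<alpha>) * (ln 5 / real n + ln (real n) / real n)) \<longlongrightarrow> pressure (mp_map \<alpha>) geom) G"
      unfolding pressure_geom by (rule tendsto_mono[OF G(2) left_orbit_average(1)])
  qed
  have zero: "{0} \<in> sets unit_borel" by (simp add: sets_restrict_space_iff)
  have "empirical_measure left_orbit n {0} = 0" for n
  proof -
    have "indicator {0} (left_orbit k) = (0::real)" for k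
      using left_orbit_pos[of k] by (simp add: indicator_def)
    then show ?thesis by (simp add: empirical_measure_def)
  qed
  then have "\<mu> {0} = 0" using tendsto_unique[OF G(1) \<mu>[of "{0}"], of 0] by simp
  then have "?r \<mu> {0} \<noteq> ?r (\<lambda>A. indicator A (0::real)) {0}" using zero by simp
  then have "?r \<mu> \<noteq> ?r (\<lambda>A. indicator A (0::real))" by metis
  then have "card {?r \<mu>, ?r (\<lambda>A. indicator A (0::real))} = 2" by simp
  moreover have "{?r \<mu>, ?r (\<lambda>A. indicator A (0::real))} \<subseteq> tangent_functionals (mp_map \<alpha>) geom"
    using dirac cluster by (simp only: insert_subset empty_subsetI simp_thms)
  ultimately show ?thesis by (intro exI conjI)
qed

text \<open>
  Raising the potential at \<open>0\<close> raises the pressure by as much, because of the fixed point; lowering it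
  there does not lower the pressure, because the backward orbit avoids \<open>0\<close>.
\<close>

lemma not_differentiable_in_direction_0:
  "\<not> ((\<lambda>t. (pressure (mp_map \<alpha>) (\<lambda>x. geom x + t * indicator {0} x) - pressure (mp_map \<alpha>) geom) / t)
    \<longlongrightarrow> L) (at 0)"
proof
  let ?P = "\<lambda>t. pressure (mp_map \<alpha>) (\<lambda>x. geom x + t * indicator {0} x)"
  assume lim: "((\<lambda>t. (?P t - pressure (mp_map \<alpha>) geom) / t) \<longlongrightarrow> L) (at 0)"
  have bounded: "bounded ((\<lambda>x. t * indicator {0} x) ` {0..1::real})" for t :: real
    unfolding bounded_iff by (intro exI[of _ "\<bar>t\<bar>"]) (auto simp: indicator_def)
  have ge_t: "t \<le> ?P t" for t using pressure_ge_at_0[OF bounded[of t]] by simp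
  have ge_0: "0 \<le> ?P t" for t
  proof -
    interpret bounded_potential "mp_map \<alpha>" 2 "\<lambda>x. geom x + t * indicator {0} x"
      by (rule bounded_potential_perturbed[OF bounded])
    have "indicator {0} (left_orbit k) = (0::real)" for k
      using left_orbit_pos[of k] by (simp add: indicator_def)
    then show ?thesis
      by (intro pressure_ge_orbit[where y = left_orbit, OF left_orbit_mem mp_map_left_orbit
            trivial_limit_sequentially order_refl left_orbit_average(1)])
        (use left_orbit_average(2) in simp)
  qed
  have "1 \<le> L"
  proof (rule tendsto_lowerbound[OF filterlim_at_split[THEN iffD1, OF lim, THEN conjunct2]])
    show "\<forall>\<^sub>F t in at_right 0. 1 \<le> (?P t - pressure (mp_map \<alpha>) geom) / t"
      using ge_t by (auto simp: eventually_at_right_field pressure_geom field_simps intro!: exI[of _ 1])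
  qed simp
  moreover have "L \<le> 0"
  proof (rule tendsto_upperbound[OF filterlim_at_split[THEN iffD1, OF lim, THEN conjunct1]])
    show "\<forall>\<^sub>F t in at_left 0. (?P t - pressure (mp_map \<alpha>) geom) / t \<le> 0"
      using ge_0 by (auto simp: eventually_at_left_field pressure_geom divide_le_0_iff intro!: exI[of _ "-1"])
  qed simp
  ultimately show False by simp
qed

end

theorem corollary7p22:
  fixes \<alpha> :: real
  assumes "\<alpha> \<ge> 1"
  shows "(\<exists>S \<subseteq> tangent_functionals (mp_map \<alpha>) (geometric_potential \<alpha>). card S = 2)
    \<and> gateaux_differentiable_at continuous_functions (pressure (mp_map \<alpha>)) (geometric_potential \<alpha>)
    \<and> \<not> gateaux_differentiable_at bounded_borel (pressure (mp_map \<alpha>)) (geometric_potential \<alpha>)"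
proof (intro conjI)
  interpret manneville_pomeau \<alpha> by unfold_locales fact
  show "\<exists>S \<subseteq> tangent_functionals (mp_map \<alpha>) (geometric_potential \<alpha>). card S = 2"
    by (rule two_tangent_functionals)
  show "gateaux_differentiable_at continuous_functions (pressure (mp_map \<alpha>)) (geometric_potential \<alpha>)"
    unfolding gateaux_differentiable_at_def continuous_functions_def
    using pressure_continuous_derivative by blast
  have "indicator {0} \<in> bounded_borel"
    unfolding bounded_borel_def bounded_iff
    by (auto intro!: measurable_restrict_space1 exI[of _ 1] simp: indicator_def)
  then show "\<not> gateaux_differentiable_at bounded_borel (pressure (mp_map \<alpha>)) (geometric_potential \<alpha>)"
    unfolding gateaux_differentiable_at_def using not_differentiable_in_direction_0 by blast
qed

end
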